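(* Let $d,n\ge 1$ be integers, let $E$ be an open set in $\mathbb{R}^d$, and let $f$ be a real-valued $C^1$ function on $E$. Then $f$ is locally $M_n$-monotone on $E$ if and only if $f\in\mathcal{L}^d_n(E)$.
   Context: $CSAM_n^d$ is the set of $d$-tuples $S=(S^1,\dots,S^d)$ of pairwise commuting self-adjoint complex $n\times n$ matrices. For such $S$, $\sigma(S)\subset\mathbb{R}^d$ is the set of joint eigenvalues, and for a real-valued function $f$ on $\sigma(S)$, $f(S)$ is defined by the joint functional calculus. For $d$-tuples of self-adjoint matrices, $S\le T$ means $S^r\le T^r$ for every $r=1,\dots,d$ (so $\Delta\ge 0$ means $\Delta^r\ge0$ for every $r$). Superscripts denote coordinates: $x=(x^1,\dots,x^d)$. A real-valued $C^1$ function $f$ on an open set $E\subseteq\mathbb{R}^d$ is locally $M_n$-monotone on $E$ if, whenever $S\in CSAM_n^d$ with $\sigma(S)=\{x_1,\dots,x_n\}$ consisting of $n$ distinct points in $E$, and $S(t)$ is a $C^1$ curve in $CSAM_n^d$ with $S(0)=S$ and $\frac{d}{dt}S(t)|_{t=0}\ge 0$, then $\frac{d}{dt}f(S(t))|_{t=0}$ exists and is $\ge 0$. $\mathcal{L}_n^d(E)$ is the set of all real-valued $C^1$ functions $f$ on $E$ with the following property: whenever $x_1,\dots,x_n$ are $n$ distinct points in $E$, there exist positive semi-definite $n\times n$ matrices $A^1,\dots,A^d$ such that $$A^r(i,i)=\frac{\partial f}{\partial x^r}\Big|_{x_i}\quad\text{and}\quad f(x_j)-f(x_i)=\sum_{r=1}^d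 (x_j^r-x_i^r)A^r(i,j)$$ for all $1\le i,j\le n$ and $1\le r\le d$. *)

theory Defs
  imports "HOL-Analysis.Analysis"
begin

text \<open>
  The size \<open>n\<close> of the matrices and the number \<open>d\<close> of variables are the cardinalities of the finite
  index types \<open>'n\<close> and \<open>'d\<close>. A \<open>d\<close>-tuple of \<open>n \<times> n\<close> complex matrices is an element of
  \<open>complex^'n^'n^'d\<close>, and its \<open>r\<close>-th coordinate is \<open>S $ r\<close>.
\<close>

definition conj_transpose :: "complex^'n^'m \<Rightarrow> complex^'m^'n" where
  "conj_transpose A = (\<chi> i j. cnj (A $ j $ i))"

definition self_adjoint :: "complex^'n^'n \<Rightarrow> bool" where
  "self_adjoint A \<longleftrightarrow> conj_transpose A = A"

text \<open>The quadratic form of a self-adjoint matrix is real, so taking \<open>Re\<close> loses nothing.\<close>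

definition psd :: "complex^'n^'n \<Rightarrow> bool" where
  "psd A \<longleftrightarrow> self_adjoint A \<and> (\<forall>v. 0 \<le> Re (\<Sum>i\<in>UNIV. cnj (v $ i) * (A *v v) $ i))"

definition unitary_mat :: "complex^'n^'n \<Rightarrow> bool" where
  "unitary_mat U \<longleftrightarrow> conj_transpose U ** U = mat 1 \<and> U ** conj_transpose U = mat 1"

definition diag_mat :: "('n \<Rightarrow> complex) \<Rightarrow> complex^'n^'n" where
  "diag_mat a = (\<chi> i j. if i = j then a i else 0)"

definition CSAM :: "(complex^'n^'n^'d) set" where
  "CSAM = {S. (\<forall>r. self_adjoint (S $ r)) \<and> (\<forall>r s. S $ r ** S $ s = S $ s ** S $ r)}"

definition joint_spectrum :: "complex^'n^'n^'d \<Rightarrow> (real^'d) set" where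
  "joint_spectrum S = {x. \<exists>v. v \<noteq> 0 \<and> (\<forall>r. S $ r *v v = x $ r *\<^sub>R v)}"

definition joint_diagonalization ::
    "complex^'n^'n \<Rightarrow> ('n \<Rightarrow> real^'d) \<Rightarrow> complex^'n^'n^'d \<Rightarrow> bool" where
  "joint_diagonalization U x S \<longleftrightarrow> unitary_mat U \<and>
     (\<forall>r. S $ r = U ** diag_mat (\<lambda>i. of_real (x i $ r)) ** conj_transpose U)"

text \<open>
  The joint functional calculus: if \<open>S\<^sup>r = U diag(x\<^sub>1\<^sup>r, \<dots>, x\<^sub>n\<^sup>r) U\<^sup>*\<close> for all \<open>r\<close> with a
  single unitary \<open>U\<close>, then \<open>f(S) = U diag(f(x\<^sub>1), \<dots>, f(x\<^sub>n)) U\<^sup>*\<close>. Independence of the choice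
  of \<open>U\<close> and \<open>x\<close> is shown in \<open>joint_calculus_eq\<close> below. The \<open>x\<^sub>i\<close> run through the joint spectrum,
  so only the values of \<open>f\<close> there matter.
\<close>

definition joint_calculus :: "(real^'d \<Rightarrow> real) \<Rightarrow> complex^'n^'n^'d \<Rightarrow> complex^'n^'n" where
  "joint_calculus f S = (THE M. \<exists>U x. joint_diagonalization U x S \<and>
     M = U ** diag_mat (\<lambda>i. of_real (f (x i))) ** conj_transpose U)"

lemma diag_mat_mult_nth:
  "(diag_mat a ** W) $ i $ j = a i * W $ i $ j" "(W ** diag_mat a) $ i $ j = W $ i $ j * a j"
  by (simp_all add: diag_mat_def matrix_matrix_mult_def if_distrib if_distribR cong: if_cong)

lemma joint_calculus_eq:
  assumes "joint_diagonalization U x S"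
  shows "joint_calculus f S = U ** diag_mat (\<lambda>i. of_real (f (x i))) ** conj_transpose U"
proof -
  have "V ** diag_mat (\<lambda>i. of_real (f (y i))) ** conj_transpose V =
        U ** diag_mat (\<lambda>i. of_real (f (x i))) ** conj_transpose U"
    if "joint_diagonalization V y S" for V y
  proof -
    have U: "conj_transpose U ** U = mat 1" "U ** conj_transpose U = mat 1"
      and V: "conj_transpose V ** V = mat 1" "V ** conj_transpose V = mat 1"
      using assms that by (auto simp: joint_diagonalization_def unitary_mat_def)
    define W where "W = conj_transpose V ** U"
    have conj: "V ** A ** conj_transpose V = U ** B ** conj_transpose U \<longleftrightarrow> A ** W = W ** B"
      for A B
    proof
      assume "V ** A ** conj_transpose V = U ** B ** conj_transpose U"
      then have "conj_transpose V ** (V ** A ** conj_transpose V) ** U =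
                 conj_transpose V ** (U ** B ** conj_transpose U) ** U"
        by simp
      then have "(conj_transpose V ** V) ** A ** W = W ** B ** (conj_transpose U ** U)"
        by (simp add: W_def matrix_mul_assoc)
      then show "A ** W = W ** B"
        by (simp add: U V)
    next
      assume "A ** W = W ** B"
      then have "V ** (A ** W) ** conj_transpose U = V ** (W ** B) ** conj_transpose U"
        by simp
      then have "V ** A ** conj_transpose V ** (U ** conj_transpose U) =
                 (V ** conj_transpose V) ** U ** B ** conj_transpose U"
        by (simp add: W_def matrix_mul_assoc)
      then show "V ** A ** conj_transpose V = U ** B ** conj_transpose U"
        by (simp add: U V)
    qed
    have "diag_mat (\<lambda>i. of_real (y i $ r)) ** W = W ** diag_mat (\<lambda>i. of_real (x i $ r))" for r
      using assms that by (simp add: joint_diagonalization_def flip: conj)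
    then have "of_real (y i $ r) * W $ i $ j = W $ i $ j * of_real (x j $ r)" for i j r
      by (metis diag_mat_mult_nth)
    then have "W $ i $ j = 0 \<or> y i = x j" for i j
      by (simp add: vec_eq_iff mult.commute) blast
    then have "of_real (f (y i)) * W $ i $ j = W $ i $ j * of_real (f (x j))" for i j
      by (metis mult.commute mult_zero_left)
    then have "diag_mat (\<lambda>i. of_real (f (y i))) ** W = W ** diag_mat (\<lambda>i. of_real (f (x i)))"
      by (simp add: vec_eq_iff diag_mat_mult_nth)
    then show ?thesis
      by (simp add: conj)
  qed
  then show ?thesis
    unfolding joint_calculus_def using assms by (intro the_equality) blast+
qed

text \<open>
  Functions on \<open>E\<close> are represented by total functions; nothing below depends on their values
  outside \<open>E\<close>.
\<close>

definition C1_on :: "(real^'d) set \<Rightarrow> (real^'d \<Rightarrow> real) \<Rightarrow> bool" where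
  "C1_on E f \<longleftrightarrow> (\<exists>g. (\<forall>x\<in>E. GDERIV f x :> g x) \<and> continuous_on E g)"

definition partial_deriv :: "'d \<Rightarrow> (real^'d \<Rightarrow> real) \<Rightarrow> real^'d \<Rightarrow> real" where
  "partial_deriv r f x = deriv (\<lambda>t. f (x + t *\<^sub>R axis r 1)) 0"

text \<open>
  Curves are defined on an open interval around \<open>0\<close>. Since \<open>E\<close> is open, the joint spectrum of
  \<open>S t\<close> lies in \<open>E\<close> for small \<open>t\<close>, which is all that the derivative at \<open>0\<close> depends on.
\<close>

definition locally_Mn_monotone ::
    "'n::finite itself \<Rightarrow> (real^'d) set \<Rightarrow> (real^'d \<Rightarrow> real) \<Rightarrow> bool" where
  "locally_Mn_monotone _ E f \<longleftrightarrow> C1_on E f \<and>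
     (\<forall>(x :: 'n \<Rightarrow> real^'d) (S :: real \<Rightarrow> complex^'n^'n^'d) \<Delta> \<epsilon>.
        inj x \<and> range x \<subseteq> E \<and> joint_spectrum (S 0) = range x \<and>
        0 < \<epsilon> \<and> S C1_differentiable_on {-\<epsilon><..<\<epsilon>} \<and> (\<forall>t\<in>{-\<epsilon><..<\<epsilon>}. S t \<in> CSAM) \<and>
        (S has_vector_derivative \<Delta>) (at 0) \<and> (\<forall>r. psd (\<Delta> $ r)) \<longrightarrow>
        (\<exists>D. ((\<lambda>t. joint_calculus f (S t)) has_vector_derivative D) (at 0) \<and> psd D))"

definition Loewner_class :: "'n::finite itself \<Rightarrow> (real^'d) set \<Rightarrow> (real^'d \<Rightarrow> real) set" where
  "Loewner_class _ E = {f. C1_on E f \<and>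
     (\<forall>x :: 'n \<Rightarrow> real^'d. inj x \<and> range x \<subseteq> E \<longrightarrow>
        (\<exists>A :: complex^'n^'n^'d.
           (\<forall>r. psd (A $ r)) \<and>
           (\<forall>i r. A $ r $ i $ i = of_real (partial_deriv r f (x i))) \<and>
           (\<forall>i j. of_real (f (x j) - f (x i)) =
                    (\<Sum>r\<in>UNIV. of_real (x j $ r - x i $ r) * A $ r $ i $ j))))}"

end

theory Submission
  imports Defs
begin

text \<open>
  After a unitary change of basis \<open>S(0) = diag(x\<^sub>1, \<dots>, x\<^sub>n)\<close>. Differentiating the commutation
  relations shows that the derivative \<open>D\<close> of \<open>f(S(t))\<close> at \<open>0\<close> satisfies
  \<open>D\<^sub>i\<^sub>j (x\<^sub>j\<^sup>r - x\<^sub>i\<^sup>r) = \<Delta>\<^sup>r\<^sub>i\<^sub>j (f(x\<^sub>j) - f(x\<^sub>i))\<close>, so the matrices \<open>A\<^sup>r\<close> of the Loewner class give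
  \<open>D = \<Sum>\<^sub>r A\<^sup>r \<circ> \<Delta>\<^sup>r\<close> (entrywise products), which is positive semidefinite by Schur's product
  theorem. That \<open>D\<close> exists is obtained without perturbation theory: \<open>f\<close> agrees to first order at
  all \<open>x\<^sub>i\<close> with a polynomial, and the joint eigenvalues of \<open>S(t)\<close> have distance \<open>O(t)\<close> from
  \<open>{x\<^sub>1, \<dots>, x\<^sub>n}\<close>, so the difference contributes only \<open>o(t)\<close>.

  Conversely, if no \<open>A\<close> exists, a linear functional separates the data of \<open>f\<close> from the closed cone
  of all data coming from tuples of positive semidefinite matrices. This functional amounts to
  \<open>\<Delta>\<^sup>r = diag(\<delta>\<^sup>r) + [k, diag(x\<^sup>r)] \<ge> 0\<close> with \<open>k\<close> skew-adjoint, and the curve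
  \<open>exp(t k) diag(x + t \<delta>) exp(-t k)\<close> with derivative \<open>\<Delta>\<close> contradicts monotonicity, since the sum
  of the entries of the derivative of \<open>f\<close> along it is the negative value of the functional.
\<close>

subsection \<open>Simultaneous diagonalization\<close>

lemma self_adjoint_operator_eigenvector:
  fixes L :: "'a::euclidean_space \<Rightarrow> 'a"
  assumes "linear L" and sym: "\<And>v w. v \<bullet> L w = L v \<bullet> w"
    and V: "subspace V" "V \<noteq> {0}" "\<And>v. v \<in> V \<Longrightarrow> L v \<in> V"
  obtains c v where "v \<in> V" "v \<noteq> 0" "L v = c *\<^sub>R v"
proof -
  note lin = linear_add[OF \<open>linear L\<close>] linear_scale[OF \<open>linear L\<close>] linear_0[OF \<open>linear L\<close>]
  have L_cont: "continuous_on A L" for A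
    using \<open>linear L\<close> linear_continuous_on linear_conv_bounded_linear by blast
  define K where "K = V \<inter> sphere 0 1"
  have "compact K"
    unfolding K_def by (intro closed_Int_compact closed_subspace V compact_sphere)
  moreover have "K \<noteq> {}"
  proof -
    obtain v where "v \<in> V" "v \<noteq> 0"
      using V subspace_0 by blast
    then have "(1 / norm v) *\<^sub>R v \<in> K"
      by (simp add: K_def V(1) subspace_scale)
    then show ?thesis by blast
  qed
  moreover have "continuous_on K (\<lambda>v. v \<bullet> L v)"
    by (intro continuous_intros L_cont)
  ultimately obtain v where v: "v \<in> K" and max: "\<And>w. w \<in> K \<Longrightarrow> w \<bullet> L w \<le> v \<bullet> L v"
    by (metis continuous_attains_sup)
  define c where "c = v \<bullet> L v"
  have vv: "v \<bullet> v = 1" "v \<in> V"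
    using v by (auto simp: K_def norm_eq_1)
  have bound: "w \<bullet> L w \<le> c * (w \<bullet> w)" if "w \<in> V" for w
  proof (cases "w = 0")
    case False
    define a where "a = 1 / norm w"
    have "a *\<^sub>R w \<in> K"
      using that False by (simp add: K_def a_def V(1) subspace_scale)
    from max[OF this] have "a\<^sup>2 * (w \<bullet> L w) \<le> c"
      by (simp add: lin c_def power2_eq_square mult.assoc)
    then show ?thesis
      using False by (simp add: a_def power_divide field_simps power2_norm_eq_inner)
  qed (simp add: lin)
  define z where "z = c *\<^sub>R v - L v"
  have "z \<in> V"
    unfolding z_def using V vv by (intro subspace_diff subspace_scale) auto
  have vz: "v \<bullet> z = 0"
    by (simp add: z_def inner_diff_right vv c_def)
  define b where "b = c * (z \<bullet> z) - z \<bullet> L z"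
  have q: "0 \<le> 2 * s * (z \<bullet> z) + s\<^sup>2 * b" for s
  proof -
    have "v + s *\<^sub>R z \<in> V"
      using V \<open>z \<in> V\<close> vv by (intro subspace_add subspace_scale) auto
    from bound[OF this] have "0 \<le> c * (1 + s\<^sup>2 * (z \<bullet> z)) - (c + 2 * s * (z \<bullet> L v) + s\<^sup>2 * (z \<bullet> L z))"
      using vz sym[of v z]
      by (simp add: lin inner_add inner_commute vv c_def power2_eq_square algebra_simps)
    also have "z \<bullet> L v = - (z \<bullet> z)"
    proof -
      have "z \<bullet> z = c * (z \<bullet> v) - z \<bullet> L v"
        by (subst (2) z_def) (simp add: inner_diff_right)
      then show ?thesis using vz by (simp add: inner_commute)
    qed
    finally show ?thesis by (simp add: b_def algebra_simps)
  qed
  have "z \<bullet> z = 0"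
  proof (rule ccontr)
    assume "z \<bullet> z \<noteq> 0"
    then have pos: "z \<bullet> z > 0" by simp
    define m where "m = \<bar>b\<bar> + 1"
    have "m > 0" "b < m" by (auto simp: m_def)
    have "0 \<le> 2 * (- (z \<bullet> z) / m) * (z \<bullet> z) + (- (z \<bullet> z) / m)\<^sup>2 * b"
      by (rule q)
    also have "\<dots> = (z \<bullet> z)\<^sup>2 / m * (b / m - 2)"
      using \<open>m > 0\<close> by (simp add: field_simps power2_eq_square)
    also have "\<dots> < 0"
      using pos \<open>m > 0\<close> \<open>b < m\<close> by (intro mult_pos_neg) (auto simp: field_simps)
    finally show False by simp
  qed
  then have "L v = c *\<^sub>R v" by (simp add: z_def)
  moreover have "v \<noteq> 0" using vv by auto
  ultimately show ?thesis using that vv by blast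
qed

lemma joint_eigenvector:
  fixes L :: "'r \<Rightarrow> 'a::euclidean_space \<Rightarrow> 'a"
  assumes "finite R" and lin: "\<And>r. linear (L r)" and sym: "\<And>r v w. v \<bullet> L r w = L r v \<bullet> w"
    and comm: "\<And>r s v. L r (L s v) = L s (L r v)"
    and V: "subspace V" "V \<noteq> {0}" "\<And>r v. v \<in> V \<Longrightarrow> L r v \<in> V"
  shows "\<exists>v x. v \<in> V \<and> v \<noteq> 0 \<and> (\<forall>r\<in>R. L r v = x r *\<^sub>R v)"
  using \<open>finite R\<close> V
proof (induction R arbitrary: V rule: finite_induct)
  case empty
  then show ?case using subspace_0 by blast
next
  case (insert s R)
  obtain c v where v: "v \<in> V" "v \<noteq> 0" "L s v = c *\<^sub>R v"
    by (rule self_adjoint_operator_eigenvector[of "L s" V, OF lin sym insert.prems])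
  define V' where "V' = {v \<in> V. L s v = c *\<^sub>R v}"
  have "subspace V'"
    using insert.prems(1)
    by (simp add: subspace_def V'_def linear_add[OF lin] linear_scale[OF lin] linear_0[OF lin] scaleR_add_right mult.commute)
  moreover have "V' \<noteq> {0}" using v by (auto simp: V'_def)
  moreover have "L r v \<in> V'" if "v \<in> V'" for r v
    using that insert.prems(3)[of v r] comm[of s r v] by (simp add: V'_def linear_scale[OF lin])
  ultimately have "\<exists>w x. w \<in> V' \<and> w \<noteq> 0 \<and> (\<forall>r\<in>R. L r w = x r *\<^sub>R w)"
    by (rule insert.IH)
  then obtain w x where w: "w \<in> V'" "w \<noteq> 0" "\<forall>r\<in>R. L r w = x r *\<^sub>R w"
    by blast
  then have "\<forall>r\<in>insert s R. L r w = (x(s := c)) r *\<^sub>R w"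
    using insert.hyps by (auto simp: V'_def)
  with w show ?case
    by (intro exI[of _ w] exI[of _ "x(s := c)"]) (simp add: V'_def)
qed

definition cdot :: "complex^'n \<Rightarrow> complex^'n \<Rightarrow> complex" where
  "cdot v w = (\<Sum>i\<in>UNIV. cnj (v $ i) * w $ i)"

lemma conj_transpose_nth [simp]: "conj_transpose A $ i $ j = cnj (A $ j $ i)"
  by (simp add: conj_transpose_def)

lemma conj_transpose_conj_transpose [simp]: "conj_transpose (conj_transpose A) = A"
  by (simp add: vec_eq_iff)

lemma conj_transpose_mult: "conj_transpose (A ** B) = conj_transpose B ** conj_transpose A"
  by (simp add: vec_eq_iff matrix_matrix_mult_def mult.commute)

lemma conj_transpose_diag_mat [simp]:
  "conj_transpose (diag_mat a) = diag_mat (\<lambda>i. cnj (a i))"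
  by (simp add: vec_eq_iff diag_mat_def)

lemma diag_mat_nth: "diag_mat a $ i $ j = (if i = j then a i else 0)"
  by (simp add: diag_mat_def)

lemma diag_mat_mult: "diag_mat a ** diag_mat b = diag_mat (\<lambda>i. a i * b i)"
  by (simp add: vec_eq_iff diag_mat_mult_nth) (simp add: diag_mat_nth)

lemma self_adjoint_iff: "self_adjoint A \<longleftrightarrow> (\<forall>i j. cnj (A $ j $ i) = A $ i $ j)"
  by (simp add: self_adjoint_def vec_eq_iff)

lemma cdot_adjoint: "cdot v (A *v w) = cdot (conj_transpose A *v v) w"
  by (simp add: cdot_def matrix_vector_mult_def sum_distrib_left sum_distrib_right mult_ac)
     (rule sum.swap)

lemma Re_cdot: "Re (cdot v w) = v \<bullet> w"
  by (simp add: cdot_def inner_vec_def inner_complex_def)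

lemma cdot_self: "cdot v v = of_real ((norm v)\<^sup>2)"
proof -
  have "cdot v v = of_real (\<Sum>i\<in>UNIV. (norm (v $ i))\<^sup>2)"
    by (simp add: cdot_def mult.commute[of "cnj _"] flip: complex_norm_square)
  then show ?thesis by (simp add: norm_vec_def L2_set_def sum_nonneg)
qed

lemma cnj_cdot: "cnj (cdot v w) = cdot w v"
  by (simp add: cdot_def mult.commute)

lemma cdot_scaleR: "cdot (c *\<^sub>R v) w = c *\<^sub>R cdot v w" "cdot v (c *\<^sub>R w) = c *\<^sub>R cdot v w"
  by (simp_all add: cdot_def scaleR_sum_right)

lemma cdot_add_right: "cdot v (w + z) = cdot v w + cdot v z"
  by (simp add: cdot_def sum.distrib algebra_simps)

lemma cdot_zero_right [simp]: "cdot v 0 = 0"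
  by (simp add: cdot_def)

lemma self_adjoint_inner:
  "self_adjoint A \<Longrightarrow> v \<bullet> (A *v w) = (A *v v) \<bullet> w"
  by (simp add: cdot_adjoint self_adjoint_def flip: Re_cdot)

lemma exists_orthogonal_vector:
  fixes u :: "'n::finite \<Rightarrow> complex^'n"
  assumes "I \<noteq> UNIV"
  obtains w where "w \<noteq> 0" "\<And>i. i \<in> I \<Longrightarrow> cdot (u i) w = 0"
proof -
  define B :: "complex^'n^'n" where "B = (\<chi> i j. if i \<in> I then cnj (u i $ j) else 0)"
  obtain k where "k \<notin> I" using assms by blast
  then have "row k B = 0"
    by (simp add: B_def row_def vec_eq_iff)
  then have "\<not> invertible B"
    using det_zero_row(2) invertible_det_nz by blast
  then have "\<not> (\<exists>C. C ** B = mat 1)"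
    using invertible_left_inverse by blast
  then obtain w where w: "B *v w = 0" "w \<noteq> 0"
    using matrix_left_invertible_ker[of B] by blast
  have "cdot (u i) w = 0" if "i \<in> I" for i
  proof -
    have "cdot (u i) w = (B *v w) $ i"
      using that by (simp add: cdot_def matrix_vector_mult_def B_def)
    then show ?thesis using w by simp
  qed
  with w that show ?thesis by blast
qed

lemma orthonormal_joint_eigenvectors:
  fixes S :: "complex^'n^'n^'d"
  assumes "S \<in> CSAM" and "finite I"
  shows "\<exists>u (x :: 'n \<Rightarrow> real^'d).
    (\<forall>i\<in>I. \<forall>j\<in>I. cdot (u i) (u j) = (if i = j then 1 else 0)) \<and>
    (\<forall>i\<in>I. \<forall>r. S $ r *v u i = x i $ r *\<^sub>R u i)"
  using \<open>finite I\<close>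
proof (induction I rule: finite_induct)
  case (insert k I)
  then obtain u x where
    u: "\<And>i j. i \<in> I \<Longrightarrow> j \<in> I \<Longrightarrow> cdot (u i) (u j) = (if i = j then 1 else 0)" and
    x: "\<And>i r. i \<in> I \<Longrightarrow> S $ r *v u i = (x i :: real^'d) $ r *\<^sub>R u i" by blast
  have sa: "self_adjoint (S $ r)" and comm: "S $ r ** S $ s = S $ s ** S $ r" for r s
    using \<open>S \<in> CSAM\<close> by (auto simp: CSAM_def)
  define V where "V = {w. \<forall>i\<in>I. cdot (u i) w = 0}"
  have "subspace V"
    by (auto simp: V_def subspace_def cdot_add_right cdot_scaleR)
  moreover obtain w where "w \<noteq> 0" "\<And>i. i \<in> I \<Longrightarrow> cdot (u i) w = 0"
    using exists_orthogonal_vector[of I u] insert.hyps by blast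
  then have "V \<noteq> {0}" by (auto simp: V_def)
  moreover have "S $ r *v v \<in> V" if "v \<in> V" for r v
  proof -
    have "cdot (u i) (S $ r *v v) = 0" if "i \<in> I" for i
      using that \<open>v \<in> V\<close> sa[of r] x[of i r]
      by (simp add: cdot_adjoint self_adjoint_def V_def cdot_scaleR)
    then show ?thesis by (simp add: V_def)
  qed
  ultimately have "\<exists>v y. v \<in> V \<and> v \<noteq> 0 \<and> (\<forall>r\<in>UNIV. S $ r *v v = y r *\<^sub>R v)"
    by (intro joint_eigenvector self_adjoint_inner[OF sa] matrix_vector_mul_linear)
      (simp_all add: matrix_vector_mul_assoc comm)
  then obtain v y where v: "v \<in> V" "v \<noteq> 0" and y: "\<And>r. S $ r *v v = y r *\<^sub>R v"
    by blast
  define e where "e = (1 / norm v) *\<^sub>R v"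
  have "norm e = 1"
    using v by (simp add: e_def)
  then have e: "cdot e e = 1"
    by (simp add: cdot_self)
  have eu: "cdot (u i) e = 0" if "i \<in> I" for i
    using v that by (simp add: V_def e_def cdot_scaleR)
  then have ue: "cdot e (u i) = 0" if "i \<in> I" for i
    using that by (metis cnj_cdot complex_cnj_zero)
  have Se: "S $ r *v e = (\<chi> r. y r) $ r *\<^sub>R e" for r
    using y[of r] by (simp add: e_def linear_scale[OF matrix_vector_mul_linear])
  show ?case
    using insert.hyps u x e eu ue Se
    by (intro exI[of _ "u(k := e)"] exI[of _ "x(k := (\<chi> r. y r))"]) auto
qed simp

lemma matrix_diag_conj_nth:
  fixes U :: "complex^'n^'n"
  shows
  "(U ** diag_mat a ** conj_transpose U) $ i $ j = (\<Sum>k\<in>UNIV. U $ i $ k * a k * cnj (U $ j $ k))"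
proof -
  have "(U ** diag_mat a ** conj_transpose U) $ i $ j =
      (\<Sum>k\<in>UNIV. (U ** diag_mat a) $ i $ k * conj_transpose U $ k $ j)"
    unfolding matrix_matrix_mult_def[of "U ** diag_mat a"] by simp
  then show ?thesis
    by (simp only: diag_mat_mult_nth conj_transpose_nth)
qed


lemma unitary_matD:
  assumes "unitary_mat U"
  shows "conj_transpose U ** U = mat 1" "U ** conj_transpose U = mat 1"
    "conj_transpose U ** (U ** A) = A" "U ** (conj_transpose U ** A) = A"
    "A ** U ** conj_transpose U = A" "A ** conj_transpose U ** U = A"
proof -
  show U: "conj_transpose U ** U = mat 1" "U ** conj_transpose U = mat 1"
    using assms by (simp_all add: unitary_mat_def)
  show "conj_transpose U ** (U ** A) = A" "U ** (conj_transpose U ** A) = A"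
    unfolding matrix_mul_assoc by (simp_all add: U)
  show "A ** U ** conj_transpose U = A" "A ** conj_transpose U ** U = A"
    unfolding matrix_mul_assoc[symmetric] by (simp_all add: U)
qed

theorem joint_diagonalization_exists:
  fixes S :: "complex^'n^'n^'d"
  assumes "S \<in> CSAM"
  obtains U x where "joint_diagonalization U x S"
proof -
  obtain u x where
    u: "\<And>i j. cdot (u i) (u j) = (if i = j then 1 else 0)" and
    x: "\<And>i r. S $ r *v u i = (x i :: real^'d) $ r *\<^sub>R u (i::'n)"
    using orthonormal_joint_eigenvectors[OF assms finite_class.finite_UNIV] by blast
  define U :: "complex^'n^'n" where "U = (\<chi> i j. u j $ i)"
  have "conj_transpose U ** U = mat 1"
    using u by (simp add: vec_eq_iff matrix_matrix_mult_def U_def cdot_def mat_def)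
  then have U: "unitary_mat U"
    using matrix_left_right_inverse by (auto simp: unitary_mat_def)
  have "S $ r ** U = U ** diag_mat (\<lambda>i. of_real (x i $ r))" for r
    using x[where r = r] unfolding vec_eq_iff diag_mat_mult_nth vector_scaleR_component
    by (simp add: matrix_matrix_mult_def matrix_vector_mult_def U_def mult.commute)
       (simp add: scaleR_conv_of_real)
  then have "S $ r = U ** diag_mat (\<lambda>i. of_real (x i $ r)) ** conj_transpose U" for r
    using unitary_matD(5)[OF U, of "S $ r"] by simp
  then show ?thesis using U that by (auto simp: joint_diagonalization_def)
qed

lemma self_adjoint_diagonalization:
  fixes A :: "complex^'n^'n"
  assumes "self_adjoint A"
  obtains U and a :: "'n \<Rightarrow> real"
  where "unitary_mat U" "A = U ** diag_mat (\<lambda>i. of_real (a i)) ** conj_transpose U"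
proof -
  have "(\<chi> r. A) \<in> (CSAM :: (complex^'n^'n^1) set)"
    using assms by (simp add: CSAM_def)
  then obtain U x where "joint_diagonalization U x ((\<chi> r. A) :: complex^'n^'n^1)"
    using joint_diagonalization_exists by blast
  then show ?thesis using that[of U "\<lambda>i. x i $ 1"] by (auto simp: joint_diagonalization_def)
qed

subsection \<open>Positive semidefinite matrices\<close>

lemma psd_iff_cdot: "psd A \<longleftrightarrow> self_adjoint A \<and> (\<forall>v. 0 \<le> Re (cdot v (A *v v)))"
  by (simp add: psd_def cdot_def)

lemma psdD: "psd A \<Longrightarrow> self_adjoint A" "psd A \<Longrightarrow> 0 \<le> Re (cdot v (A *v v))"
  by (simp_all add: psd_iff_cdot)

lemma cdot_matrix_vector_mult:
  "cdot v (A *v w) = (\<Sum>i\<in>UNIV. \<Sum>j\<in>UNIV. cnj (v $ i) * A $ i $ j * w $ j)"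
  by (simp add: cdot_def matrix_vector_mult_def sum_distrib_left mult.assoc)

lemma cdot_axis_left: "cdot (axis i a) w = cnj a * w $ i"
proof -
  have "cdot (axis i a) w = (\<Sum>k\<in>UNIV. if k = i then cnj a * w $ i else 0)"
    unfolding cdot_def by (intro sum.cong) (auto simp: axis_def)
  then show ?thesis by simp
qed

lemma matrix_vector_mult_axis_nth: "((A :: complex^'n^'m) *v axis j b) $ i = A $ i $ j * b"
proof -
  have "(A *v axis j b) $ i = (\<Sum>k\<in>UNIV. if k = j then A $ i $ j * b else 0)"
    unfolding matrix_vector_mult_def vec_lambda_beta by (intro sum.cong) (auto simp: axis_def)
  then show ?thesis by simp
qed

lemma self_adjoint_conj:
  "self_adjoint A \<Longrightarrow> self_adjoint (U ** A ** conj_transpose U)"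
  by (simp add: self_adjoint_def conj_transpose_mult matrix_mul_assoc)

lemma psd_conj: "psd A \<Longrightarrow> psd (U ** A ** conj_transpose U)"
  by (simp add: psd_iff_cdot self_adjoint_conj cdot_adjoint[of _ U] flip: matrix_vector_mul_assoc)

lemma psd_conj': "psd A \<Longrightarrow> psd (conj_transpose U ** A ** U)"
  using psd_conj[of A "conj_transpose U"] by simp

lemma matrix_vector_mult_sum:
  fixes A :: "'i \<Rightarrow> complex^'n^'m"
  shows "(\<Sum>r\<in>R. A r) *v v = (\<Sum>r\<in>R. A r *v v)"
  by (induction R rule: infinite_finite_induct) (auto simp: matrix_vector_mult_add_rdistrib)

lemma psd_sum:
  assumes "\<And>r. r \<in> R \<Longrightarrow> psd (A r)"
  shows "psd (\<Sum>r\<in>R. A r)"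
proof -
  have "cdot v ((\<Sum>r\<in>R. A r) *v v) = (\<Sum>r\<in>R. cdot v (A r *v v))" for v
    unfolding matrix_vector_mult_sum by (induction R rule: infinite_finite_induct) (auto simp: cdot_add_right)
  then show ?thesis
    using assms by (auto simp: psd_iff_cdot self_adjoint_iff intro!: sum_nonneg)
qed

text \<open>Writing \<open>B = \<Sum>\<^sub>k b\<^sub>k u\<^sub>k u\<^sub>k\<^sup>*\<close> turns the quadratic form of the entrywise product into a
  nonnegative combination of values of the quadratic form of \<open>A\<close>.\<close>

lemma psd_Schur_product:
  assumes A: "psd A" and B: "psd B"
  shows "psd (\<chi> i j. A $ i $ j * B $ i $ j)"
proof -
  obtain U b where U: "unitary_mat U" "B = U ** diag_mat (\<lambda>i. of_real (b i)) ** conj_transpose U"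
    by (rule self_adjoint_diagonalization[OF psdD(1)[OF B]])
  have b: "0 \<le> b k" for k
  proof -
    have "psd (conj_transpose U ** B ** U)"
      using B by (rule psd_conj')
    also have "conj_transpose U ** B ** U = diag_mat (\<lambda>i. of_real (b i))"
      by (simp add: U(2) unitary_matD(1,3)[OF U(1)] matrix_mul_assoc[symmetric])
    finally have "0 \<le> Re (cdot (axis k 1) (diag_mat (\<lambda>i. of_real (b i)) *v axis k 1))"
      by (rule psdD)
    also have "cdot (axis k 1) (diag_mat (\<lambda>i. of_real (b i)) *v axis k 1) = of_real (b k)"
      by (simp add: cdot_axis_left matrix_vector_mult_axis_nth diag_mat_nth)
    finally show ?thesis by simp
  qed
  have "0 \<le> Re (cdot v ((\<chi> i j. A $ i $ j * B $ i $ j) *v v))" for v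
  proof -
    define w where "w k = (\<chi> i. cnj (U $ i $ k) * v $ i)" for k
    have "cdot v ((\<chi> i j. A $ i $ j * B $ i $ j) *v v) =
        (\<Sum>i\<in>UNIV. \<Sum>j\<in>UNIV. \<Sum>k\<in>UNIV. of_real (b k) * (cnj (w k $ i) * A $ i $ j * w k $ j))"
      unfolding cdot_matrix_vector_mult U(2)
      by (intro sum.cong refl)
        (simp add: matrix_diag_conj_nth w_def sum_distrib_left sum_distrib_right mult_ac)
    also have "\<dots> = (\<Sum>i\<in>UNIV. \<Sum>k\<in>UNIV. \<Sum>j\<in>UNIV. of_real (b k) * (cnj (w k $ i) * A $ i $ j * w k $ j))"
      by (rule sum.cong[OF refl sum.swap])
    also have "\<dots> = (\<Sum>k\<in>UNIV. \<Sum>i\<in>UNIV. \<Sum>j\<in>UNIV. of_real (b k) * (cnj (w k $ i) * A $ i $ j * w k $ j))"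
      by (rule sum.swap)
    also have "\<dots> = (\<Sum>k\<in>UNIV. of_real (b k) * cdot (w k) (A *v w k))"
      by (simp add: cdot_matrix_vector_mult sum_distrib_left)
    finally show ?thesis
      using b psdD(2)[OF A] by (auto intro!: sum_nonneg mult_nonneg_nonneg)
  qed
  then show ?thesis
    using psdD(1)[OF A] psdD(1)[OF B] by (auto simp: psd_iff_cdot self_adjoint_iff)
qed

lemma cdot_add_left: "cdot (v + w) z = cdot v z + cdot w z"
  by (simp add: cdot_def sum.distrib algebra_simps)

lemma psd_entry_bound:
  assumes "psd A"
  shows "2 * norm (A $ i $ j) \<le> Re (A $ i $ i) + Re (A $ j $ j)"
proof -
  define z where "z = (if A $ i $ j = 0 then 1 else - cnj (sgn (A $ i $ j)))"
  have z: "cnj z * z = 1"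
  proof -
    have "norm z = 1" by (simp add: z_def norm_sgn)
    then show ?thesis
      by (metis complex_norm_square mult.commute of_real_1 one_power2)
  qed
  have Az: "A $ i $ j * z = - of_real (norm (A $ i $ j))"
  proof -
    have "A $ i $ j * cnj (A $ i $ j) = of_real (norm (A $ i $ j)) * of_real (norm (A $ i $ j))"
      by (simp add: power2_eq_square flip: complex_norm_square)
    then show ?thesis
      by (auto simp: z_def sgn_div_norm scaleR_conv_of_real field_simps)
  qed
  have ji: "A $ j $ i = cnj (A $ i $ j)"
    using psdD(1)[OF assms] by (simp add: self_adjoint_iff)
  have zA: "cnj z * A $ j $ i = - of_real (norm (A $ i $ j))"
    using arg_cong[OF Az, of cnj] by (simp add: ji mult.commute)
  let ?v = "axis i 1 + axis j z"
  have "cdot ?v (A *v ?v) = A $ i $ i + A $ i $ j * z + cnj z * A $ j $ i + cnj z * z * A $ j $ j"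
    by (simp add: matrix_vector_right_distrib cdot_add_left cdot_add_right cdot_axis_left
        matrix_vector_mult_axis_nth algebra_simps)
  also have "\<dots> = A $ i $ i + A $ j $ j - 2 * of_real (norm (A $ i $ j))"
    unfolding Az zA z by simp
  finally show ?thesis
    using psdD(2)[OF assms, of ?v] by simp
qed

lemma psd_diagonal:
  assumes "psd A"
  shows "A $ i $ i = of_real (Re (A $ i $ i))" "0 \<le> Re (A $ i $ i)"
proof -
  show "A $ i $ i = of_real (Re (A $ i $ i))"
    using psdD(1)[OF assms] by (simp add: self_adjoint_iff complex_eq_iff) (metis cnj.simps(2) equal_neg_zero)
  show "0 \<le> Re (A $ i $ i)"
    using psd_entry_bound[OF assms, of i i] norm_ge_zero[of "A $ i $ i"] by linarith
qed

lemma matrix_vector_mult_scaleR_left: "(c *\<^sub>R A) *v v = c *\<^sub>R ((A :: complex^'n^'m) *v v)"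
  by (simp add: vec_eq_iff matrix_vector_mult_def scaleR_sum_right)

lemma psd_scaleR: "psd A \<Longrightarrow> 0 \<le> c \<Longrightarrow> psd (c *\<^sub>R A)"
  by (simp add: psd_iff_cdot self_adjoint_iff matrix_vector_mult_scaleR_left cdot_scaleR)

lemma psd_add: "psd A \<Longrightarrow> psd B \<Longrightarrow> psd (A + B)"
  by (simp add: psd_iff_cdot self_adjoint_iff matrix_vector_mult_add_rdistrib cdot_add_right)

lemma psd_0: "psd 0"
  by (simp add: psd_iff_cdot self_adjoint_iff)

lemma psd_rank_one: "psd (\<chi> i j. w $ i * cnj (w $ j))"
proof -
  have "cdot v ((\<chi> i j. w $ i * cnj (w $ j)) *v v) = cnj (cdot w v) * cdot w v" for v
    unfolding cdot_matrix_vector_mult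
    unfolding cdot_def cnj_sum sum_product by (simp add: mult_ac)
  then show ?thesis
    by (simp add: psd_iff_cdot self_adjoint_iff mult.commute)
qed

lemma closed_psd: "closed {A. psd A}"
  unfolding psd_iff_cdot self_adjoint_iff cdot_matrix_vector_mult
  by (intro closed_Collect_conj closed_Collect_all closed_Collect_le closed_Collect_eq continuous_intros)

subsection \<open>Joint functional calculus\<close>

lemma diag_mat_mult_left: "diag_mat a ** (diag_mat b ** C) = diag_mat (\<lambda>i. a i * b i) ** C"
  by (simp add: matrix_mul_assoc diag_mat_mult)

lemma joint_diagonalization_CSAM:
  assumes "joint_diagonalization U x S"
  shows "S \<in> CSAM"
proof -
  have U: "unitary_mat U"
    and S: "\<And>r. S $ r = U ** diag_mat (\<lambda>i. of_real (x i $ r)) ** conj_transpose U"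
    using assms by (auto simp: joint_diagonalization_def)
  have "self_adjoint (S $ r)" for r
    unfolding S by (rule self_adjoint_conj) (simp add: self_adjoint_def)
  moreover have "S $ r ** S $ s = U ** diag_mat (\<lambda>i. of_real (x i $ r) * of_real (x i $ s)) ** conj_transpose U" for r s
    by (simp add: S unitary_matD(3)[OF U] diag_mat_mult_left flip: matrix_mul_assoc)
  then have "S $ r ** S $ s = S $ s ** S $ r" for r s
    by (simp add: mult.commute)
  ultimately show ?thesis by (simp add: CSAM_def)
qed

lemma joint_diagonalization_eigenvector:
  assumes "joint_diagonalization U x S"
  shows "S $ r *v column k U = x k $ r *\<^sub>R column k U" "norm (column k U) = 1"
proof -
  have U: "unitary_mat U"
    and S: "\<And>r. S $ r = U ** diag_mat (\<lambda>i. of_real (x i $ r)) ** conj_transpose U"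
    using assms by (auto simp: joint_diagonalization_def)
  have "S $ r ** U = U ** diag_mat (\<lambda>i. of_real (x i $ r))"
    unfolding S by (rule unitary_matD(6)[OF U])
  then have "(S $ r ** U) $ i $ k = U $ i $ k * of_real (x k $ r)" for i
    by (simp add: diag_mat_mult_nth)
  then show "S $ r *v column k U = x k $ r *\<^sub>R column k U"
    by (simp add: vec_eq_iff matrix_matrix_mult_def matrix_vector_mult_def column_def)
       (simp add: scaleR_conv_of_real)
  have "cdot (column k U) (column k U) = (conj_transpose U ** U) $ k $ k"
    by (simp add: cdot_def column_def matrix_matrix_mult_def)
  also have "\<dots> = 1"
    by (simp add: unitary_matD[OF U] mat_def)
  finally have "(norm (column k U))\<^sup>2 = 1"
    unfolding cdot_self using of_real_eq_1_iff by blast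
  then have "(norm (column k U))\<^sup>2 = 1\<^sup>2" by simp
  then show "norm (column k U) = 1"
    by (rule power2_eq_imp_eq) simp_all
qed

lemma joint_spectrum_eq_range:
  assumes "joint_diagonalization U x S"
  shows "joint_spectrum S = range x"
proof (intro equalityI subsetI)
  fix y assume "y \<in> range x"
  then obtain k where "y = x k" by blast
  then show "y \<in> joint_spectrum S"
    using joint_diagonalization_eigenvector[OF assms, where k = k]
    by (force simp: joint_spectrum_def intro!: exI[of _ "column k U"])
next
  fix y assume "y \<in> joint_spectrum S"
  then obtain v where v: "v \<noteq> 0" "\<And>r. S $ r *v v = y $ r *\<^sub>R v"
    by (auto simp: joint_spectrum_def)
  have U: "unitary_mat U"
    and S: "\<And>r. S $ r = U ** diag_mat (\<lambda>i. of_real (x i $ r)) ** conj_transpose U"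
    using assms by (auto simp: joint_diagonalization_def)
  define w where "w = conj_transpose U *v v"
  have v_eq: "v = U *v w"
    by (simp add: w_def matrix_vector_mul_assoc unitary_matD[OF U])
  then have "w \<noteq> 0" using v by auto
  then obtain k where k: "w $ k \<noteq> 0" by (auto simp: vec_eq_iff)
  have "diag_mat (\<lambda>i. of_real (x i $ r)) *v w = y $ r *\<^sub>R w" for r
  proof -
    have "diag_mat (\<lambda>i. of_real (x i $ r)) *v w = conj_transpose U *v (S $ r *v v)"
      unfolding S w_def
      by (simp add: matrix_vector_mul_assoc unitary_matD(3)[OF U] flip: matrix_mul_assoc)
    then show ?thesis
      by (simp add: v(2) w_def linear_scale[OF matrix_vector_mul_linear])
  qed
  then have "of_real (x k $ r) * w $ k = y $ r *\<^sub>R w $ k" for r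
    by (simp add: vec_eq_iff matrix_vector_mult_def diag_mat_nth if_distrib if_distribR cong: if_cong)
  then have "x k $ r = y $ r" for r
    using k by (simp add: scaleR_conv_of_real)
  then have "y = x k" by (simp add: vec_eq_iff)
  then show "y \<in> range x" by simp
qed

lemma joint_diagonalization_conj:
  assumes "joint_diagonalization U x S" and V: "unitary_mat V"
  shows "joint_diagonalization (V ** U) x (\<chi> r. V ** S $ r ** conj_transpose V)"
proof -
  have U: "unitary_mat U"
    and S: "\<And>r. S $ r = U ** diag_mat (\<lambda>i. of_real (x i $ r)) ** conj_transpose U"
    using assms by (auto simp: joint_diagonalization_def)
  show ?thesis
    by (simp add: joint_diagonalization_def unitary_mat_def S conj_transpose_mult
        unitary_matD(1-4)[OF U] unitary_matD(1-4)[OF V] matrix_mul_assoc[symmetric])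
qed

lemma joint_calculus_conj:
  assumes "S \<in> CSAM" and "unitary_mat V"
  shows "joint_calculus f (\<chi> r. V ** S $ r ** conj_transpose V) =
    V ** joint_calculus f S ** conj_transpose V"
proof -
  obtain U x where "joint_diagonalization U x S"
    using joint_diagonalization_exists assms by blast
  with joint_calculus_eq[OF this] joint_calculus_eq[OF joint_diagonalization_conj[OF this assms(2)]]
  show ?thesis by (simp add: conj_transpose_mult matrix_mul_assoc)
qed

lemma bounded_bilinear_matrix_mult:
  "bounded_bilinear ((**) :: complex^'n^'m \<Rightarrow> complex^'p^'n \<Rightarrow> complex^'p^'m)"
proof -
  have "bilinear ((**) :: complex^'n^'m \<Rightarrow> complex^'p^'n \<Rightarrow> complex^'p^'m)"
    unfolding bilinear_def
    by (intro conjI allI linearI)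
      (simp_all add: vec_eq_iff matrix_matrix_mult_def algebra_simps sum.distrib scaleR_sum_right)
  then show ?thesis by (simp add: bilinear_conv_bounded_bilinear)
qed

lemma has_vector_derivative_vecI:
  fixes f :: "real \<Rightarrow> 'a::euclidean_space^'n"
  assumes "\<And>i. ((\<lambda>t. f t $ i) has_vector_derivative D $ i) (at t within T)"
  shows "(f has_vector_derivative D) (at t within T)"
  unfolding has_vector_derivative_def has_derivative_within
proof
  show "bounded_linear (\<lambda>s. s *\<^sub>R D)" by (rule bounded_linear_scaleR_left)
  show "((\<lambda>y. (1 / norm (y - t)) *\<^sub>R (f y - (f t + (y - t) *\<^sub>R D))) \<longlongrightarrow> 0) (at t within T)"
    using assms by (intro vec_tendstoI) (auto simp: has_vector_derivative_def has_derivative_within)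
qed

lemma has_vector_derivative_vec_nth:
  "(f has_vector_derivative D) F \<Longrightarrow> ((\<lambda>t. f t $ i) has_vector_derivative D $ i) F"
  by (rule bounded_linear.has_vector_derivative[OF bounded_linear_vec_nth])

lemmas has_vector_derivative_matrix_mult =
  bounded_bilinear.has_vector_derivative[OF bounded_bilinear_matrix_mult]

lemma has_vector_derivative_matrix_conj:
  fixes V :: "complex^'n^'n"
  assumes "(A has_vector_derivative D) F"
  shows "((\<lambda>t. V ** A t ** W) has_vector_derivative V ** D ** W) F"
  by (intro bounded_linear.has_vector_derivative[OF bounded_bilinear.bounded_linear_left[OF bounded_bilinear_matrix_mult]]
      bounded_linear.has_vector_derivative[OF bounded_bilinear.bounded_linear_right[OF bounded_bilinear_matrix_mult]] assms)

lemma joint_calculus_eqI: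
  assumes "S \<in> CSAM"
    and "\<And>U x. joint_diagonalization U x S \<Longrightarrow>
      M = U ** diag_mat (\<lambda>i. of_real (f (x i))) ** conj_transpose U"
  shows "joint_calculus f S = M"
proof -
  obtain U x where "joint_diagonalization U x S"
    by (rule joint_diagonalization_exists[OF assms(1)])
  then show ?thesis
    using assms(2) joint_calculus_eq by metis
qed

lemma joint_diagonalizationD:
  assumes "joint_diagonalization U x S"
  shows "unitary_mat U" "S $ r = U ** diag_mat (\<lambda>i. of_real (x i $ r)) ** conj_transpose U"
  using assms by (auto simp: joint_diagonalization_def)

lemma joint_calculus_const:
  assumes "S \<in> CSAM"
  shows "joint_calculus (\<lambda>_. c) S = diag_mat (\<lambda>_. of_real c)"
proof (rule joint_calculus_eqI[OF assms])
  fix U x assume U: "joint_diagonalization U x S"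
  have "U ** diag_mat (\<lambda>_. of_real c) = diag_mat (\<lambda>_. of_real c) ** U"
    by (simp add: vec_eq_iff diag_mat_mult_nth)
  then show "diag_mat (\<lambda>_. of_real c) = U ** diag_mat (\<lambda>_. of_real c) ** conj_transpose U"
    by (simp add: unitary_matD(5)[OF joint_diagonalizationD(1)[OF U]])
qed

lemma joint_calculus_add:
  assumes "S \<in> CSAM"
  shows "joint_calculus (\<lambda>y. f y + g y) S = joint_calculus f S + joint_calculus g S"
proof (rule joint_calculus_eqI[OF assms])
  fix U x assume U: "joint_diagonalization U x S"
  show "joint_calculus f S + joint_calculus g S =
      U ** diag_mat (\<lambda>i. of_real (f (x i) + g (x i))) ** conj_transpose U"
    unfolding joint_calculus_eq[OF U] vec_eq_iff
    by (simp add: matrix_diag_conj_nth algebra_simps sum.distrib)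
qed

lemma joint_calculus_mult:
  assumes "S \<in> CSAM"
  shows "joint_calculus (\<lambda>y. f y * g y) S = joint_calculus f S ** joint_calculus g S"
proof (rule joint_calculus_eqI[OF assms])
  fix U x assume U: "joint_diagonalization U x S"
  show "joint_calculus f S ** joint_calculus g S =
      U ** diag_mat (\<lambda>i. of_real (f (x i) * g (x i))) ** conj_transpose U"
    unfolding joint_calculus_eq[OF U]
    by (simp add: unitary_matD(3)[OF joint_diagonalizationD(1)[OF U]] diag_mat_mult_left
        matrix_mul_assoc[symmetric])
qed

lemma joint_calculus_nth:
  assumes "S \<in> CSAM"
  shows "joint_calculus (\<lambda>y. y $ r) S = S $ r"
  by (rule joint_calculus_eqI[OF assms]) (rule joint_diagonalizationD)

lemma joint_calculus_commute:
  assumes "S \<in> CSAM"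
  shows "joint_calculus f S ** S $ r = S $ r ** joint_calculus f S"
  using joint_calculus_mult[OF assms, of f "\<lambda>y. y $ r"]
    joint_calculus_mult[OF assms, of "\<lambda>y. y $ r" f]
  by (simp add: joint_calculus_nth[OF assms] mult.commute)

lemma joint_calculus_sum:
  assumes "S \<in> CSAM" "finite R"
  shows "joint_calculus (\<lambda>y. \<Sum>r\<in>R. f r y) S = (\<Sum>r\<in>R. joint_calculus (f r) S)"
  using assms(2)
  by (induction R rule: finite_induct)
    (auto simp: joint_calculus_add[OF assms(1)] joint_calculus_const[OF assms(1)] vec_eq_iff
      diag_mat_nth)

lemma linear_functional_cart:
  fixes p :: "real^'d \<Rightarrow> real"
  assumes "linear p"
  shows "p y = (\<Sum>r\<in>UNIV. p (axis r 1) * y $ r)"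
proof -
  have "p y = p (\<Sum>r\<in>UNIV. y $ r *s axis r 1)"
    by (simp only: basis_expansion)
  also have "\<dots> = (\<Sum>r\<in>UNIV. y $ r * p (axis r 1))"
    by (simp add: scalar_mult_eq_scaleR linear_sum[OF assms] linear_scale[OF assms])
  finally show ?thesis by (simp add: mult.commute)
qed

lemma norm_vec_le_sum: "norm (v :: 'a::real_normed_vector^'n) \<le> (\<Sum>i\<in>UNIV. norm (v $ i))"
  by (simp add: norm_vec_def L2_set_le_sum)

lemma norm_matrix_le:
  fixes A :: "complex^'n^'m" and B :: real
  assumes "\<And>i j. norm (A $ i $ j) \<le> B"
  shows "norm A \<le> CARD('m) * (CARD('n) * B)"
proof -
  have "norm (A $ i) \<le> CARD('n) * B" for i
    by (rule order.trans[OF norm_vec_le_sum]) (intro sum_bounded_above assms)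
  then show ?thesis
    by (intro order.trans[OF norm_vec_le_sum]) (intro sum_bounded_above)
qed

lemma joint_eigenvalue_near_diagonal:
  fixes T A :: "complex^'n^'n^'d" and x :: "'n \<Rightarrow> real^'d"
  assumes v: "norm v = 1" "\<And>r. T $ r *v v = z $ r *\<^sub>R v"
    and A: "\<And>r. A $ r = diag_mat (\<lambda>i. of_real (x i $ r))"
  shows "\<exists>i. norm (z - x i) \<le> CARD('d) * (CARD('n))\<^sup>2 * norm (T - A)"
proof -
  let ?n = "real CARD('n)"
  obtain i where i: "norm (v $ i) \<ge> 1 / ?n"
  proof (rule ccontr)
    assume "\<not> thesis"
    then have "norm (v $ i) < 1 / ?n" for i
      using that by (meson not_le)
    then have "(\<Sum>i\<in>UNIV. norm (v $ i)) < (\<Sum>i\<in>(UNIV::'n set). 1 / ?n)"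
      by (intro sum_strict_mono) auto
    then show False
      using norm_vec_le_sum[of v] v(1) by simp
  qed
  have "\<bar>(z - x i) $ r\<bar> \<le> ?n\<^sup>2 * norm (T - A)" for r
  proof -
    have "((T - A) $ r *v v) $ i = of_real ((z - x i) $ r) * v $ i"
    proof -
      have "(A $ r *v v) $ i = (\<Sum>j\<in>UNIV. if j = i then of_real (x i $ r) * v $ i else 0)"
        unfolding A matrix_vector_mult_def vec_lambda_beta
        by (intro sum.cong) (auto simp: diag_mat_nth)
      then show ?thesis
        by (simp add: matrix_vector_mult_diff_rdistrib v(2) algebra_simps)
          (simp add: scaleR_conv_of_real)
    qed
    then have "\<bar>(z - x i) $ r\<bar> * norm (v $ i) = norm (((T - A) $ r *v v) $ i)"
      by (simp only: norm_mult norm_of_real)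
    also have "\<dots> \<le> (\<Sum>j\<in>UNIV. norm ((T - A) $ r $ i $ j * v $ j))"
      unfolding matrix_vector_mult_def vec_lambda_beta by (rule norm_sum)
    also have "\<dots> \<le> of_nat CARD('n) * norm (T - A)"
    proof (rule sum_bounded_above)
      fix j
      have "norm ((T - A) $ r $ i $ j) \<le> norm (T - A)"
        by (meson Finite_Cartesian_Product.norm_nth_le order.trans)
      moreover have "norm (v $ j) \<le> 1"
        using Finite_Cartesian_Product.norm_nth_le[of v j] v(1) by simp
      ultimately show "norm ((T - A) $ r $ i $ j * v $ j) \<le> norm (T - A)"
        unfolding norm_mult using mult_mono[of _ "norm (T - A)" _ 1] by force
    qed
    finally have 1: "\<bar>(z - x i) $ r\<bar> * norm (v $ i) \<le> ?n * norm (T - A)" by simp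
    have "\<bar>(z - x i) $ r\<bar> * (1 / ?n) \<le> \<bar>(z - x i) $ r\<bar> * norm (v $ i)"
      using i by (intro mult_left_mono) auto
    with 1 have "\<bar>(z - x i) $ r\<bar> * (1 / ?n) \<le> ?n * norm (T - A)" by linarith
    then show ?thesis
      by (simp add: field_simps power2_eq_square)
  qed
  then have "(\<Sum>r\<in>UNIV. norm ((z - x i) $ r)) \<le> of_nat CARD('d) * (?n\<^sup>2 * norm (T - A))"
    by (intro sum_bounded_above) simp
  then have "norm (z - x i) \<le> CARD('d) * (CARD('n))\<^sup>2 * norm (T - A)"
    using norm_vec_le_sum[of "z - x i"] by (simp add: mult.assoc)
  then show ?thesis by blast
qed

lemma norm_joint_calculus_le:
  fixes S :: "complex^'n^'n^'d" and B :: real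
  assumes U: "joint_diagonalization U x S" and B: "\<And>k. \<bar>q (x k)\<bar> \<le> B"
  shows "norm (joint_calculus q S) \<le> CARD('n) * (CARD('n) * (CARD('n) * B))"
proof (rule norm_matrix_le)
  fix i j
  have u: "norm (U $ i $ k) \<le> 1" for i k
    using Finite_Cartesian_Product.norm_nth_le[of "column k U" i]
      joint_diagonalization_eigenvector(2)[OF U, of k] by (simp add: column_def)
  have "norm (joint_calculus q S $ i $ j) \<le>
      (\<Sum>k\<in>UNIV. norm (U $ i $ k * of_real (q (x k)) * cnj (U $ j $ k)))"
    unfolding joint_calculus_eq[OF U] matrix_diag_conj_nth by (rule norm_sum)
  also have "\<dots> \<le> of_nat CARD('n) * B"
  proof (rule sum_bounded_above)
    fix k
    have "norm (U $ i $ k) * \<bar>q (x k)\<bar> * norm (U $ j $ k) \<le> 1 * B * 1"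
      using u B by (intro mult_mono) (auto intro: order.trans[OF abs_ge_zero])
    then show "norm (U $ i $ k * of_real (q (x k)) * cnj (U $ j $ k)) \<le> B"
      by (simp add: norm_mult)
  qed
  finally show "norm (joint_calculus q S $ i $ j) \<le> CARD('n) * B" by simp
qed

subsection \<open>Differentiating the functional calculus\<close>

definition curve_at_diagonal ::
    "(real \<Rightarrow> complex^'n^'n^'d) \<Rightarrow> complex^'n^'n^'d \<Rightarrow> ('n \<Rightarrow> real^'d) \<Rightarrow> real \<Rightarrow> bool" where
  "curve_at_diagonal S \<Delta> x \<epsilon> \<longleftrightarrow> 0 < \<epsilon> \<and> (\<forall>t. \<bar>t\<bar> < \<epsilon> \<longrightarrow> S t \<in> CSAM) \<and>
     (S has_vector_derivative \<Delta>) (at 0) \<and>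
     (\<forall>r. S 0 $ r = diag_mat (\<lambda>i. of_real (x i $ r))) \<and> (\<forall>r. self_adjoint (\<Delta> $ r))"

lemma curve_at_diagonalD:
  assumes "curve_at_diagonal S \<Delta> x \<epsilon>"
  shows "0 < \<epsilon>" "\<bar>t\<bar> < \<epsilon> \<Longrightarrow> S t \<in> CSAM" "(S has_vector_derivative \<Delta>) (at 0)"
    "S 0 $ r = diag_mat (\<lambda>i. of_real (x i $ r))" "self_adjoint (\<Delta> $ r)"
  using assms by (simp_all add: curve_at_diagonal_def)

lemma joint_calculus_at_0:
  fixes S :: "real \<Rightarrow> complex^'n^'n^'d"
  assumes C: "curve_at_diagonal S \<Delta> x \<epsilon>"
  shows "joint_calculus f (S 0) = diag_mat (\<lambda>i. of_real (f (x i)))"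
proof -
  have one: "conj_transpose (mat 1) = (mat 1 :: complex^'n^'n)"
    by (simp add: vec_eq_iff mat_def)
  then have "joint_diagonalization (mat 1) x (S 0)"
    by (simp add: joint_diagonalization_def unitary_mat_def curve_at_diagonalD(4)[OF C])
  from joint_calculus_eq[OF this] show ?thesis
    by (simp add: one)
qed

lemma has_vector_derivative_transform_ball:
  assumes "(g has_vector_derivative D) (at 0)" "0 < \<epsilon>" "\<And>t. \<bar>t\<bar> < \<epsilon> \<Longrightarrow> g t = h t"
  shows "(h has_vector_derivative D) (at 0)"
  by (rule has_vector_derivative_transform_within[OF assms(1,2)]) (auto intro: assms(3))

definition diagonal_velocity :: "complex^'n^'n^'d \<Rightarrow> 'n \<Rightarrow> real^'d" where
  "diagonal_velocity \<Delta> i = (\<chi> r. Re (\<Delta> $ r $ i $ i))"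

lemma diagonal_velocity_nth:
  assumes C: "curve_at_diagonal S \<Delta> x \<epsilon>"
  shows "\<Delta> $ r $ i $ i = of_real (diagonal_velocity \<Delta> i $ r)"
proof -
  have "cnj (\<Delta> $ r $ i $ i) = \<Delta> $ r $ i $ i"
    using curve_at_diagonalD(5)[OF C] by (simp add: self_adjoint_iff)
  then show ?thesis by (simp add: diagonal_velocity_def complex_eq_iff)
qed

lemma polynomial_calculus_derivative:
  assumes C: "curve_at_diagonal S \<Delta> x \<epsilon>"
    and "real_polynomial_function p"
  shows "\<exists>p' D. (\<forall>i. (p has_derivative p' i) (at (x i))) \<and>
    ((\<lambda>t. joint_calculus p (S t)) has_vector_derivative D) (at 0) \<and>
    (\<forall>i. D $ i $ i = of_real (p' i (diagonal_velocity \<Delta> i)))"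
proof -
  note CSAM = curve_at_diagonalD(2)[OF C]
    and deriv = curve_at_diagonalD(3)[OF C]
    and transform = has_vector_derivative_transform_ball[OF _ curve_at_diagonalD(1)[OF C]]
    and joint_calculus_0 = joint_calculus_at_0[OF C]
  show ?thesis
    using assms(2)
  proof (induction p)
    case (linear p)
    note p = linear_functional_cart[OF bounded_linear.linear[OF linear]]
    have "((\<lambda>t. \<Sum>r\<in>UNIV. p (axis r 1) *\<^sub>R S t $ r) has_vector_derivative
        (\<Sum>r\<in>UNIV. p (axis r 1) *\<^sub>R \<Delta> $ r)) (at 0)"
      by (intro has_vector_derivative_sum bounded_linear.has_vector_derivative[OF bounded_linear_scaleR_right] has_vector_derivative_vec_nth deriv)
    moreover have "(\<Sum>r\<in>UNIV. p (axis r 1) *\<^sub>R S t $ r) = joint_calculus p (S t)" if "\<bar>t\<bar> < \<epsilon>" for t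
    proof -
      have "p = (\<lambda>y. \<Sum>r\<in>UNIV. p (axis r 1) * y $ r)"
        by (rule ext) (rule p)
      then have "joint_calculus p (S t) = joint_calculus (\<lambda>y. \<Sum>r\<in>UNIV. p (axis r 1) * y $ r) (S t)"
        by (rule arg_cong)
      also have "\<dots> = (\<Sum>r\<in>UNIV. joint_calculus (\<lambda>y. p (axis r 1)) (S t) ** (S t $ r))"
        by (simp add: joint_calculus_sum joint_calculus_mult joint_calculus_nth CSAM[OF that])
      also have "\<dots> = (\<Sum>r\<in>UNIV. p (axis r 1) *\<^sub>R S t $ r)"
        by (intro sum.cong refl)
          (simp add: joint_calculus_const[OF CSAM[OF that]] vec_eq_iff diag_mat_mult_nth,
            simp add: scaleR_conv_of_real)
      finally show ?thesis by simp
    qed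
    ultimately have "((\<lambda>t. joint_calculus p (S t)) has_vector_derivative
        (\<Sum>r\<in>UNIV. p (axis r 1) *\<^sub>R \<Delta> $ r)) (at 0)"
      by (rule transform)
    moreover have "(\<Sum>r\<in>UNIV. p (axis r 1) *\<^sub>R \<Delta> $ r) $ i $ i = of_real (p (diagonal_velocity \<Delta> i))" for i
      by (subst p[of "diagonal_velocity \<Delta> i"])
        (simp add: diagonal_velocity_nth[OF C], simp add: scaleR_conv_of_real)
    moreover have "(p has_derivative p) (at (x i))" for i
      by (rule bounded_linear.has_derivative[OF linear has_derivative_ident])
    ultimately show ?case
      by (intro exI[of _ "\<lambda>_. p"] exI[of _ "\<Sum>r\<in>UNIV. p (axis r 1) *\<^sub>R \<Delta> $ r"]) simp
  next
    case (const c)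
    have "((\<lambda>t. joint_calculus (\<lambda>_. c) (S t)) has_vector_derivative 0) (at 0)"
      by (rule transform[OF has_vector_derivative_const]) (simp add: joint_calculus_const CSAM)
    moreover have "((\<lambda>_. c) has_derivative (\<lambda>_. 0)) (at (x i))" for i
      by (rule has_derivative_const)
    ultimately show ?case
      by (intro exI[of _ "\<lambda>_ _. 0"] exI[of _ 0]) simp
  next
    case (add p q)
    then obtain p' D q' E where
      "\<And>i. (p has_derivative p' i) (at (x i))" "\<And>i. D $ i $ i = of_real (p' i (diagonal_velocity \<Delta> i))"
      "\<And>i. (q has_derivative q' i) (at (x i))" "\<And>i. E $ i $ i = of_real (q' i (diagonal_velocity \<Delta> i))"
      and D: "((\<lambda>t. joint_calculus p (S t)) has_vector_derivative D) (at 0)"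
      and E: "((\<lambda>t. joint_calculus q (S t)) has_vector_derivative E) (at 0)"
      by blast
    then have "\<And>i. ((\<lambda>y. p y + q y) has_derivative (\<lambda>h. p' i h + q' i h)) (at (x i))"
      "\<And>i. (D + E) $ i $ i = of_real (p' i (diagonal_velocity \<Delta> i) + q' i (diagonal_velocity \<Delta> i))"
      by (simp_all add: has_derivative_add)
    moreover have "((\<lambda>t. joint_calculus (\<lambda>y. p y + q y) (S t)) has_vector_derivative D + E) (at 0)"
      by (rule transform[OF has_vector_derivative_add[OF D E]]) (simp add: joint_calculus_add CSAM)
    ultimately show ?case
      by (intro exI[of _ "\<lambda>i h. p' i h + q' i h"] exI[of _ "D + E"]) simp
  next
    case (mult p q)
    then obtain p' D q' E where
      p: "\<And>i. (p has_derivative p' i) (at (x i))" "\<And>i. D $ i $ i = of_real (p' i (diagonal_velocity \<Delta> i))" and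
      q: "\<And>i. (q has_derivative q' i) (at (x i))" "\<And>i. E $ i $ i = of_real (q' i (diagonal_velocity \<Delta> i))"
      and D: "((\<lambda>t. joint_calculus p (S t)) has_vector_derivative D) (at 0)"
      and E: "((\<lambda>t. joint_calculus q (S t)) has_vector_derivative E) (at 0)"
      by blast
    have "((\<lambda>y. p y * q y) has_derivative (\<lambda>h. p (x i) * q' i h + p' i h * q (x i))) (at (x i))" for i
      by (rule has_derivative_mult[OF p(1) q(1)])
    moreover have "((\<lambda>t. joint_calculus (\<lambda>y. p y * q y) (S t)) has_vector_derivative
        joint_calculus p (S 0) ** E + D ** joint_calculus q (S 0)) (at 0)"
      by (rule transform[OF has_vector_derivative_matrix_mult[OF D E]])
        (simp add: joint_calculus_mult CSAM)
    moreover have "(joint_calculus p (S 0) ** E + D ** joint_calculus q (S 0)) $ i $ i =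
        of_real (p (x i) * q' i (diagonal_velocity \<Delta> i) + p' i (diagonal_velocity \<Delta> i) * q (x i))" for i
      by (simp add: joint_calculus_0 diag_mat_mult_nth p(2) q(2))
    ultimately show ?case
      by (intro exI[of _ "\<lambda>i h. p (x i) * q' i h + p' i h * q (x i)"]
          exI[of _ "joint_calculus p (S 0) ** E + D ** joint_calculus q (S 0)"]) simp
  qed
qed

lemma flat_calculus_derivative:
  fixes S :: "real \<Rightarrow> complex^'n^'n^'d"
  assumes C: "curve_at_diagonal S \<Delta> x \<epsilon>"
    and q: "\<And>i. (q has_derivative (\<lambda>_. 0)) (at (x i))" "\<And>i. q (x i) = 0"
  shows "((\<lambda>t. joint_calculus q (S t)) has_vector_derivative 0) (at 0)"
proof -
  note eps = curve_at_diagonalD(1)[OF C]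
    and CSAM = curve_at_diagonalD(2)[OF C]
    and deriv = curve_at_diagonalD(3)[OF C]
    and S0 = curve_at_diagonalD(4)[OF C]
    and joint_calculus_0 = joint_calculus_at_0[OF C]
  show ?thesis
    unfolding has_vector_derivative_def has_derivative_at_alt
  proof (intro conjI allI impI)
    show "bounded_linear (\<lambda>s. s *\<^sub>R (0 :: complex^'n^'n))" by simp
  next
    fix e :: real assume "e > 0"
    define K where "K = CARD('d) * (real CARD('n))\<^sup>2"
    define c where "c = norm \<Delta> + 1"
    define N where "N = real CARD('n) * (CARD('n) * CARD('n))"
    have pos: "K > 0" "c > 0" "N > 0"
      by (auto simp: K_def c_def N_def intro: add_nonneg_pos)
    define e' where "e' = e / (N * K * c)"
    have "e' > 0" using pos \<open>e > 0\<close> by (simp add: e'_def)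
    have "\<forall>i. \<exists>d>0. \<forall>y. norm (y - x i) < d \<longrightarrow> \<bar>q y\<bar> \<le> e' * norm (y - x i)"
      using q \<open>e' > 0\<close> by (simp add: has_derivative_at_alt)
    then obtain d where d: "\<And>i. d i > 0" "\<And>i y. norm (y - x i) < d i \<Longrightarrow> \<bar>q y\<bar> \<le> e' * norm (y - x i)"
      by metis
    define d0 where "d0 = Min (range d)"
    have d0: "d0 > 0" "d0 \<le> d i" for i
      using d(1) by (auto simp: d0_def)
    obtain d1 where d1: "d1 > 0" "\<And>t. \<bar>t\<bar> < d1 \<Longrightarrow> norm (S t - S 0) \<le> c * \<bar>t\<bar>"
    proof -
      obtain d1 where "d1 > 0" and d1: "\<And>t. \<bar>t\<bar> < d1 \<Longrightarrow> norm (S t - S 0 - t *\<^sub>R \<Delta>) \<le> 1 * \<bar>t\<bar>"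
        using deriv unfolding has_vector_derivative_def has_derivative_at_alt
        by (metis diff_zero real_norm_def zero_less_one)
      have "norm (S t - S 0) \<le> c * \<bar>t\<bar>" if "\<bar>t\<bar> < d1" for t
        using d1[OF that] norm_triangle_ineq[of "S t - S 0 - t *\<^sub>R \<Delta>" "t *\<^sub>R \<Delta>"]
        by (simp add: c_def algebra_simps)
      with \<open>d1 > 0\<close> that show ?thesis by blast
    qed
    define d2 where "d2 = min (min \<epsilon> d1) (d0 / (K * c))"
    have "d2 > 0" using eps d1 d0 pos by (simp add: d2_def)
    moreover have "norm (joint_calculus q (S t) - joint_calculus q (S 0) - (t - 0) *\<^sub>R 0) \<le> e * norm (t - 0)"
      if "norm (t - 0) < d2" for t
    proof -
      have t: "\<bar>t\<bar> < \<epsilon>" "\<bar>t\<bar> < d1" "K * (c * \<bar>t\<bar>) < d0"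
        using that pos by (auto simp: d2_def field_simps)
      obtain U y where U: "joint_diagonalization U y (S t)"
        by (rule joint_diagonalization_exists[OF CSAM[OF t(1)]])
      have "\<bar>q (y k)\<bar> \<le> e' * (K * (c * \<bar>t\<bar>))" for k
      proof -
        obtain i where "norm (y k - x i) \<le> K * norm (S t - S 0)"
          using joint_eigenvalue_near_diagonal[OF joint_diagonalization_eigenvector(2,1)[OF U] S0]
          unfolding K_def by auto
        also have "\<dots> \<le> K * (c * \<bar>t\<bar>)"
          using d1(2)[OF t(2)] pos by (intro mult_left_mono) auto
        finally have near: "norm (y k - x i) \<le> K * (c * \<bar>t\<bar>)" .
        then have "\<bar>q (y k)\<bar> \<le> e' * norm (y k - x i)"
          using t(3) d0(2)[of i] by (intro d(2)) linarith
        also have "\<dots> \<le> e' * (K * (c * \<bar>t\<bar>))"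
          using near \<open>e' > 0\<close> by (intro mult_left_mono) auto
        finally show ?thesis .
      qed
      from norm_joint_calculus_le[OF U, of q, OF this]
      have "norm (joint_calculus q (S t)) \<le> N * (e' * (K * (c * \<bar>t\<bar>)))"
        by (simp add: N_def mult.assoc)
      also have "\<dots> = e * \<bar>t\<bar>"
        using pos by (simp add: e'_def)
      finally show ?thesis
        using q(2) by (simp add: joint_calculus_0 diag_mat_def zero_vec_def[symmetric])
    qed
    ultimately show "\<exists>d>0. \<forall>t. norm (t - 0) < d \<longrightarrow>
        norm (joint_calculus q (S t) - joint_calculus q (S 0) - (t - 0) *\<^sub>R 0) \<le> e * norm (t - 0)"
      by blast
  qed
qed

lemma calculus_derivative_off_diagonal:
  assumes C: "curve_at_diagonal S \<Delta> x \<epsilon>"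
    and "((\<lambda>t. joint_calculus f (S t)) has_vector_derivative D) (at 0)"
  shows "D $ i $ j * of_real (x j $ r - x i $ r) = \<Delta> $ r $ i $ j * of_real (f (x j) - f (x i))"
proof -
  note CSAM = curve_at_diagonalD(2)[OF C]
    and deriv = curve_at_diagonalD(3)[OF C]
    and S0 = curve_at_diagonalD(4)[OF C]
    and transform = has_vector_derivative_transform_ball[OF _ curve_at_diagonalD(1)[OF C]]
    and joint_calculus_0 = joint_calculus_at_0[OF C]
  note r = has_vector_derivative_vec_nth[OF deriv, of r]
  have "((\<lambda>t. joint_calculus f (S t) ** S t $ r) has_vector_derivative
      joint_calculus f (S 0) ** \<Delta> $ r + D ** S 0 $ r) (at 0)"
    by (rule has_vector_derivative_matrix_mult[OF assms(2) r])
  moreover have "((\<lambda>t. joint_calculus f (S t) ** S t $ r) has_vector_derivative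
      S 0 $ r ** D + \<Delta> $ r ** joint_calculus f (S 0)) (at 0)"
    by (rule transform[OF has_vector_derivative_matrix_mult[OF r assms(2)]])
      (simp add: joint_calculus_commute CSAM)
  ultimately have "joint_calculus f (S 0) ** \<Delta> $ r + D ** S 0 $ r =
      S 0 $ r ** D + \<Delta> $ r ** joint_calculus f (S 0)"
    by (rule vector_derivative_unique_at)
  then have "(joint_calculus f (S 0) ** \<Delta> $ r + D ** S 0 $ r) $ i $ j =
      (S 0 $ r ** D + \<Delta> $ r ** joint_calculus f (S 0)) $ i $ j"
    by (rule arg_cong)
  then show ?thesis
    by (simp add: joint_calculus_0 S0 diag_mat_mult_nth algebra_simps)
qed

lemma Hermite_interpolation:
  fixes x :: "'n::finite \<Rightarrow> 'a::euclidean_space" and g :: "'n \<Rightarrow> 'a \<Rightarrow> real"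
  assumes "inj x" and g: "\<And>i. bounded_linear (g i)"
  obtains p where "real_polynomial_function p" "\<And>i. p (x i) = c i"
    "\<And>i. (p has_derivative g i) (at (x i))"
proof -
  define q where "q i y = (\<Prod>j\<in>-{i}. ((y - x j) \<bullet> (y - x j)) / ((x i - x j) \<bullet> (x i - x j)))" for i y
  have q_poly: "real_polynomial_function (q i)" for i
  proof -
    have "real_polynomial_function (\<lambda>y. (y - z) \<bullet> b)" for z b :: 'a
      unfolding inner_diff_left
      by (intro real_polynomial_function_diff real_polynomial_function.intros(1)
          real_polynomial_function.intros(2) bounded_linear_inner_left)
    then have "real_polynomial_function (\<lambda>y. \<Sum>b\<in>Basis. ((y - z) \<bullet> b) * ((y - z) \<bullet> b))" for z :: 'a
      by (intro real_polynomial_function_sum real_polynomial_function.intros(4)) auto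
    then show ?thesis
      unfolding q_def euclidean_inner[of "_ - _" "_ - _"]
      by (intro real_polynomial_function_prod real_polynomial_function_divide) auto
  qed
  have q_x: "q i (x j) = (if i = j then 1 else 0)" for i j
  proof (cases "i = j")
    case True
    have "x j - x k \<noteq> 0" if "k \<in> - {j}" for k
      using that \<open>inj x\<close> by (auto simp: inj_def)
    then have "q j (x j) = 1"
      unfolding q_def by (intro prod.neutral) simp
    with True show ?thesis by simp
  next
    case False
    then show ?thesis
      unfolding q_def by (auto intro!: prod_zero)
  qed
  define L where "L i y = q i y * q i y * (3 - 2 * q i y)" for i y
  have L_poly: "real_polynomial_function (L i)" for i
    unfolding L_def
    by (intro real_polynomial_function.intros(4) real_polynomial_function_diff
        real_polynomial_function.intros(2) q_poly)
  have L_x: "L i (x j) = (if i = j then 1 else 0)" for i j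
    by (simp add: L_def q_x)
  have L_deriv: "(L i has_derivative (\<lambda>_. 0)) (at (x j))" for i j
  proof -
    obtain q' where "(q i has_derivative q') (at (x j))"
      using differentiable_at_real_polynomial_function[OF q_poly] unfolding differentiable_def by blast
    then have "(L i has_derivative (\<lambda>h. q i (x j) * q i (x j) * (0 - 2 * q' h) +
        (q i (x j) * q' h + q' h * q i (x j)) * (3 - 2 * q i (x j)))) (at (x j))"
      unfolding L_def by (auto intro!: derivative_eq_intros)
    also have "(\<lambda>h. q i (x j) * q i (x j) * (0 - 2 * q' h) +
        (q i (x j) * q' h + q' h * q i (x j)) * (3 - 2 * q i (x j))) = (\<lambda>_. 0)"
      by (simp add: q_x)
    finally show ?thesis .
  qed
  define p where "p y = (\<Sum>i\<in>UNIV. (c i + (g i y - g i (x i))) * L i y)" for y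
  show thesis
  proof
    show "real_polynomial_function p"
      unfolding p_def
      by (intro real_polynomial_function_sum real_polynomial_function.intros(4) real_polynomial_function.intros(3)
          real_polynomial_function_diff real_polynomial_function.intros(2) real_polynomial_function.intros(1) g L_poly)
        auto
    show "p (x i) = c i" for i
      by (simp add: p_def L_x if_distrib cong: if_cong)
    show "(p has_derivative g j) (at (x j))" for j
    proof -
      have "(p has_derivative (\<lambda>h. \<Sum>i\<in>UNIV. (c i + (g i (x j) - g i (x i))) * 0 +
          (0 + (g i h - 0)) * L i (x j))) (at (x j))"
        unfolding p_def
        by (intro has_derivative_sum has_derivative_mult has_derivative_add has_derivative_diff
            has_derivative_const L_deriv bounded_linear.has_derivative[OF g] has_derivative_ident)
      also have "(\<lambda>h. \<Sum>i\<in>UNIV. (c i + (g i (x j) - g i (x i))) * 0 +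
          (0 + (g i h - 0)) * L i (x j)) = g j"
        by (simp add: L_x if_distrib cong: if_cong)
      finally show ?thesis .
    qed
  qed
qed

lemma calculus_derivative:
  assumes C: "curve_at_diagonal S \<Delta> x \<epsilon>"
    and "inj x" and f: "\<And>i. (f has_derivative f' i) (at (x i))"
  obtains D where "((\<lambda>t. joint_calculus f (S t)) has_vector_derivative D) (at 0)"
    "\<And>i. D $ i $ i = of_real (f' i (diagonal_velocity \<Delta> i))"
proof -
  note CSAM = curve_at_diagonalD(2)[OF C]
    and transform = has_vector_derivative_transform_ball[OF _ curve_at_diagonalD(1)[OF C]]
  obtain p where p: "real_polynomial_function p" "\<And>i. p (x i) = f (x i)"
    "\<And>i. (p has_derivative f' i) (at (x i))"
    using Hermite_interpolation[OF assms(2), of f' "\<lambda>i. f (x i)"] has_derivative_bounded_linear[OF f]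
    by blast
  obtain p' D where p': "\<And>i. (p has_derivative p' i) (at (x i))"
    and D: "((\<lambda>t. joint_calculus p (S t)) has_vector_derivative D) (at 0)"
      "\<And>i. D $ i $ i = of_real (p' i (diagonal_velocity \<Delta> i))"
    using polynomial_calculus_derivative[OF C p(1)] by blast
  have "p' i = f' i" for i
    using has_derivative_unique[OF p'[of i] p(3)[of i]] .
  with D have D': "\<And>i. D $ i $ i = of_real (f' i (diagonal_velocity \<Delta> i))" by simp
  have "((\<lambda>y. f y - p y) has_derivative (\<lambda>_. 0)) (at (x i))" for i
    using has_derivative_diff[OF f p(3), of i] by simp
  then have "((\<lambda>t. joint_calculus (\<lambda>y. f y - p y) (S t)) has_vector_derivative 0) (at 0)"
    by (rule flat_calculus_derivative[OF C]) (simp add: p)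
  from has_vector_derivative_add[OF this D(1)]
  have "((\<lambda>t. joint_calculus f (S t)) has_vector_derivative 0 + D) (at 0)"
    by (rule transform) (simp add: CSAM flip: joint_calculus_add)
  then show ?thesis using that D' by simp
qed

lemma partial_deriv_eq:
  assumes "(f has_derivative f') (at y)"
  shows "partial_deriv r f y = f' (axis r 1)"
proof -
  note scale = linear_scale[OF has_derivative_linear[OF assms]]
  have "((\<lambda>t. y + t *\<^sub>R axis r 1) has_derivative (\<lambda>t. t *\<^sub>R axis r 1)) (at 0)"
    by (auto intro!: derivative_eq_intros)
  moreover have "(f has_derivative f') (at (y + 0 *\<^sub>R axis r 1))"
    using assms by simp
  ultimately have "((\<lambda>t. f (y + t *\<^sub>R axis r 1)) has_derivative (\<lambda>t. f' (t *\<^sub>R axis r 1))) (at 0)"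
    by (rule has_derivative_compose)
  also have "(\<lambda>t. f' (t *\<^sub>R axis r 1)) = (*) (f' (axis r 1))"
    by (simp add: fun_eq_iff scale)
  finally have "((\<lambda>t. f (y + t *\<^sub>R axis r 1)) has_field_derivative f' (axis r 1)) (at 0)"
    by (simp add: has_field_derivative_def)
  then show ?thesis
    unfolding partial_deriv_def by (rule DERIV_imp_deriv)
qed

lemma has_derivative_partial_deriv:
  assumes "(f has_derivative f') (at y)"
  shows "f' h = (\<Sum>r\<in>UNIV. partial_deriv r f y * h $ r)"
  unfolding partial_deriv_eq[OF assms]
  by (rule linear_functional_cart[OF has_derivative_linear[OF assms]])

lemma C1_on_has_derivative:
  assumes "C1_on E f" "y \<in> E"
  obtains f' where "(f has_derivative f') (at y)"
  using assms unfolding C1_on_def gderiv_def by blast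

lemma CSAM_conj:
  assumes "S \<in> CSAM" "unitary_mat V"
  shows "(\<chi> r. V ** S $ r ** conj_transpose V) \<in> CSAM"
proof -
  obtain U x where "joint_diagonalization U x S"
    by (rule joint_diagonalization_exists[OF assms(1)])
  from joint_diagonalization_CSAM[OF joint_diagonalization_conj[OF this assms(2)]]
  show ?thesis .
qed

lemma Loewner_calculus_derivative_psd:
  assumes C: "curve_at_diagonal S \<Delta> x \<epsilon>"
    and "inj x" and f: "\<And>i. (f has_derivative f' i) (at (x i))"
    and \<Delta>: "\<And>r. psd (\<Delta> $ r)" and A: "\<And>r. psd (A $ r)"
    and A_diag: "\<And>i r. A $ r $ i $ i = of_real (partial_deriv r f (x i))"
    and A_diff: "\<And>i j. of_real (f (x j) - f (x i)) =
      (\<Sum>r\<in>UNIV. of_real (x j $ r - x i $ r) * A $ r $ i $ j)"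
  obtains D where "((\<lambda>t. joint_calculus f (S t)) has_vector_derivative D) (at 0)" "psd D"
proof -
  note CSAM = curve_at_diagonalD(2)[OF C]
    and deriv = curve_at_diagonalD(3)[OF C]
    and transform = has_vector_derivative_transform_ball[OF _ curve_at_diagonalD(1)[OF C]]
  obtain D where D: "((\<lambda>t. joint_calculus f (S t)) has_vector_derivative D) (at 0)"
    and D_diag: "\<And>i. D $ i $ i = of_real (f' i (diagonal_velocity \<Delta> i))"
    by (rule calculus_derivative[OF C assms(2,3)]) (rule that)
  have \<Delta>_comm: "\<Delta> $ r $ i $ j * of_real (x j $ s - x i $ s) = \<Delta> $ s $ i $ j * of_real (x j $ r - x i $ r)"
    for r s i j
  proof -
    have "((\<lambda>t. joint_calculus (\<lambda>y. y $ r) (S t)) has_vector_derivative \<Delta> $ r) (at 0)"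
      by (rule transform[OF has_vector_derivative_vec_nth[OF deriv]]) (simp add: joint_calculus_nth CSAM)
    from calculus_derivative_off_diagonal[OF C this] show ?thesis .
  qed
  have "D $ i $ j = (\<Sum>r\<in>UNIV. A $ r $ i $ j * \<Delta> $ r $ i $ j)" for i j
  proof (cases "i = j")
    case True
    then show ?thesis
      by (simp add: D_diag has_derivative_partial_deriv[OF f] A_diag diagonal_velocity_nth[OF C])
  next
    case False
    then have "x j \<noteq> x i"
      using \<open>inj x\<close> by (simp add: inj_eq)
    then obtain s where s: "x j $ s - x i $ s \<noteq> 0"
      by (auto simp: vec_eq_iff)
    let ?d = "complex_of_real (x j $ s - x i $ s)"
    have "(\<Sum>r\<in>UNIV. A $ r $ i $ j * \<Delta> $ r $ i $ j) * ?d =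
        (\<Sum>r\<in>UNIV. A $ r $ i $ j * (\<Delta> $ r $ i $ j * ?d))"
      by (simp only: sum_distrib_right mult.assoc)
    also have "\<dots> = (\<Sum>r\<in>UNIV. \<Delta> $ s $ i $ j * (of_real (x j $ r - x i $ r) * A $ r $ i $ j))"
      by (rule sum.cong[OF refl], subst \<Delta>_comm) (simp only: mult_ac)
    also have "\<dots> = \<Delta> $ s $ i $ j * of_real (f (x j) - f (x i))"
      unfolding A_diff by (simp only: sum_distrib_left)
    also have "\<dots> = D $ i $ j * ?d"
      by (rule calculus_derivative_off_diagonal[OF C D, symmetric])
    finally show ?thesis
      using s by (simp del: of_real_diff)
  qed
  then have "D = (\<Sum>r\<in>UNIV. (\<chi> i j. A $ r $ i $ j * \<Delta> $ r $ i $ j))"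
    by (simp add: vec_eq_iff)
  then have "psd D"
    using psd_sum[of UNIV "\<lambda>r. \<chi> i j. A $ r $ i $ j * \<Delta> $ r $ i $ j"] psd_Schur_product[OF A \<Delta>]
    by simp
  with D that show ?thesis by blast
qed

theorem Loewner_class_imp_locally_Mn_monotone:
  fixes f :: "real^'d::finite \<Rightarrow> real"
  assumes f: "f \<in> Loewner_class TYPE('n::finite) E"
  shows "locally_Mn_monotone TYPE('n) E f"
proof -
  have C1: "C1_on E f" using f by (simp add: Loewner_class_def)
  have main: "\<exists>D. ((\<lambda>t. joint_calculus f (S t)) has_vector_derivative D) (at 0) \<and> psd D"
    if x0: "inj x0" "range x0 \<subseteq> E" "joint_spectrum (S 0) = range x0"
      and \<epsilon>: "0 < \<epsilon>" and S: "\<forall>t\<in>{-\<epsilon><..<\<epsilon>}. S t \<in> CSAM"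
      and deriv: "(S has_vector_derivative \<Delta>) (at 0)" and psd: "\<forall>r. psd (\<Delta> $ r)"
    for x0 :: "'n \<Rightarrow> real^'d" and S :: "real \<Rightarrow> complex^'n^'n^'d" and \<Delta> \<epsilon>
  proof -
    have CSAM: "S t \<in> CSAM" if "\<bar>t\<bar> < \<epsilon>" for t
      by (rule bspec[OF S]) (use that in auto)
    obtain U x where U: "joint_diagonalization U x (S 0)"
      by (rule joint_diagonalization_exists[OF CSAM, of 0]) (use \<epsilon> in auto)
    have range: "range x = range x0"
      using joint_spectrum_eq_range[OF U] x0 by simp
    have "inj x"
    proof (rule eq_card_imp_inj_on)
      show "card (range x) = card (UNIV :: 'n set)"
        unfolding range using x0(1) by (rule card_image)
    qed simp
    have "range x \<subseteq> E"
      using x0(2) range by simp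
    obtain A :: "complex^'n^'n^'d" where A: "\<And>r. psd (A $ r)"
      "\<And>i r. A $ r $ i $ i = of_real (partial_deriv r f (x i))"
      "\<And>i j. of_real (f (x j) - f (x i)) = (\<Sum>r\<in>UNIV. of_real (x j $ r - x i $ r) * A $ r $ i $ j)"
      using f[unfolded Loewner_class_def mem_Collect_eq, THEN conjunct2, THEN spec, THEN mp,
          OF conjI[OF \<open>inj x\<close> \<open>range x \<subseteq> E\<close>]]
      by auto
    have "\<forall>i. \<exists>f'. (f has_derivative f') (at (x i))"
    proof
      fix i
      have "x i \<in> E" using \<open>range x \<subseteq> E\<close> by blast
      then show "\<exists>f'. (f has_derivative f') (at (x i))"
        by (rule C1_on_has_derivative[OF C1]) (rule exI)
    qed
    from choice[OF this] obtain f' where f': "\<And>i. (f has_derivative f' i) (at (x i))"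
      by (elim exE) (rule that, elim allE)
    have uU: "unitary_mat U"
      by (rule joint_diagonalizationD[OF U])
    define V where "V = conj_transpose U"
    have uV: "unitary_mat V"
      using uU by (simp add: V_def unitary_mat_def)
    define T where "T t = (\<chi> r. V ** S t $ r ** conj_transpose V)" for t
    define \<Gamma> where "\<Gamma> = (\<chi> r. V ** \<Delta> $ r ** conj_transpose V)"
    have \<Gamma>_psd: "psd (\<Gamma> $ r)" for r
      using psd by (simp add: \<Gamma>_def psd_conj)
    have C: "curve_at_diagonal T \<Gamma> x \<epsilon>"
      unfolding curve_at_diagonal_def
    proof (intro conjI allI impI)
      show "T t \<in> CSAM" if "\<bar>t\<bar> < \<epsilon>" for t
        unfolding T_def by (rule CSAM_conj[OF CSAM[OF that] uV])
      show "(T has_vector_derivative \<Gamma>) (at 0)"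
        unfolding T_def \<Gamma>_def
        by (rule has_vector_derivative_vecI, unfold vec_lambda_beta)
          (rule has_vector_derivative_matrix_conj[OF has_vector_derivative_vec_nth[OF deriv]])
      show "T 0 $ r = diag_mat (\<lambda>i. of_real (x i $ r))" for r
        using joint_diagonalizationD(2)[OF U, of r]
        by (simp add: T_def V_def unitary_matD(1,3)[OF uU] matrix_mul_assoc[symmetric])
      show "self_adjoint (\<Gamma> $ r)" for r
        by (rule psdD[OF \<Gamma>_psd])
    qed (rule \<epsilon>)
    obtain D where D: "((\<lambda>t. joint_calculus f (T t)) has_vector_derivative D) (at 0)" "psd D"
      by (rule Loewner_calculus_derivative_psd[OF C \<open>inj x\<close> f' \<Gamma>_psd A])
    have "((\<lambda>t. joint_calculus f (S t)) has_vector_derivative U ** D ** conj_transpose U) (at 0)"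
    proof (rule has_vector_derivative_transform_ball[OF has_vector_derivative_matrix_conj[OF D(1)] \<epsilon>])
      fix t assume t: "\<bar>t\<bar> < \<epsilon>"
      have "joint_calculus f (T t) = conj_transpose U ** joint_calculus f (S t) ** U"
        unfolding T_def joint_calculus_conj[OF CSAM[OF t] uV] by (simp add: V_def)
      then show "U ** joint_calculus f (T t) ** conj_transpose U = joint_calculus f (S t)"
        by (simp add: unitary_matD(2,4)[OF uU] matrix_mul_assoc[symmetric])
    qed
    moreover have "psd (U ** D ** conj_transpose U)"
      by (rule psd_conj[OF D(2)])
    ultimately show ?thesis by blast
  qed
  show ?thesis
    unfolding locally_Mn_monotone_def
  proof (intro conjI C1 allI impI, elim conjE, goal_cases)
    case (1 x S \<Delta> \<epsilon>)
    from main[OF 1(1-4) 1(6-8)] show ?case .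
  qed
qed

subsection \<open>Curves with prescribed velocity\<close>

lemma skew_part_inner:
  fixes c Z :: "complex^'n^'n"
  assumes "\<And>i j. cnj (Z $ j $ i) = - Z $ i $ j"
  shows "c \<bullet> Z = (\<chi> i j. (c $ i $ j - cnj (c $ j $ i)) / 2) \<bullet> Z"
proof -
  have cnj_inner: "cnj a \<bullet> b = a \<bullet> cnj b" for a b
    by (simp add: inner_complex_def)
  have "conj_transpose c \<bullet> Z = (\<Sum>i\<in>UNIV. \<Sum>j\<in>UNIV. c $ j $ i \<bullet> cnj (Z $ i $ j))"
    by (simp add: inner_vec_def cnj_inner)
  also have "\<dots> = (\<Sum>j\<in>UNIV. \<Sum>i\<in>UNIV. c $ j $ i \<bullet> (- Z $ j $ i))"
    unfolding assms by (rule sum.swap)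
  also have "\<dots> = - (c \<bullet> Z)"
    by (simp add: inner_vec_def sum_negf)
  finally have "(1 / 2) *\<^sub>R (c - conj_transpose c) \<bullet> Z = c \<bullet> Z"
    by (simp add: inner_diff_left)
  also have "(1 / 2) *\<^sub>R (c - conj_transpose c) = (\<chi> i j. (c $ i $ j - cnj (c $ j $ i)) / 2)"
    by (simp add: vec_eq_iff) (simp add: scaleR_conv_of_real)
  finally show ?thesis by simp
qed

lemma bounded_linear_conj_transpose:
  "bounded_linear (conj_transpose :: complex^'n^'m \<Rightarrow> complex^'m^'n)"
  unfolding linear_conv_bounded_linear[symmetric]
  by (rule linearI) (simp_all add: vec_eq_iff)

lemma has_vector_derivative_diag_mat:
  assumes "\<And>i. ((\<lambda>t. a i t) has_vector_derivative a' i) (at s)"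
  shows "((\<lambda>t. diag_mat (\<lambda>i. a i t)) has_vector_derivative diag_mat a') (at s)"
proof (intro has_vector_derivative_vecI)
  fix i j
  show "((\<lambda>t. diag_mat (\<lambda>i. a i t) $ i $ j) has_vector_derivative diag_mat a' $ i $ j) (at s)"
    using assms[of i] by (cases "i = j") (simp_all add: diag_mat_nth)
qed

lemma continuous_on_diag_mat:
  fixes a :: "'n::finite \<Rightarrow> 'a::topological_space \<Rightarrow> complex"
  assumes "\<And>i. continuous_on T (\<lambda>t. a i t)"
  shows "continuous_on T (\<lambda>t. diag_mat (\<lambda>i. a i t))"
  unfolding diag_mat_def
proof (intro continuous_on_vec_lambda)
  fix i j :: 'n
  show "continuous_on T (\<lambda>t. if i = j then a i t else 0)"
    using assms[of i] by (cases "i = j") simp_all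
qed

lemmas continuous_on_matrix_mult = bounded_bilinear.continuous_on[OF bounded_bilinear_matrix_mult]

lemma continuous_on_conj_transpose:
  "continuous_on T W \<Longrightarrow> continuous_on T (\<lambda>t. conj_transpose (W t))"
  by (rule bounded_linear.continuous_on[OF bounded_linear_conj_transpose])

text \<open>The curve is \<open>t \<mapsto> exp (t k)\<close>; the exponential is taken on the eigenvalues of \<open>k\<close>.\<close>

lemma unitary_curve_exists:
  fixes k :: "complex^'n^'n"
  assumes "conj_transpose k = - k"
  obtains W W' where "\<And>t :: real. unitary_mat (W t)"
    "\<And>t. (W has_vector_derivative W' t) (at t)" "\<And>T. continuous_on T W'"
    "W 0 = mat 1" "W' 0 = k"
proof -
  have "self_adjoint (\<chi> i j. - \<i> * k $ i $ j)"
    using assms by (simp add: self_adjoint_iff vec_eq_iff)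
  then obtain V and \<theta> :: "'n \<Rightarrow> real" where V: "unitary_mat V"
    and k: "(\<chi> i j. - \<i> * k $ i $ j) = V ** diag_mat (\<lambda>i. of_real (\<theta> i)) ** conj_transpose V"
    by (rule self_adjoint_diagonalization)
  define W where "W t = V ** diag_mat (\<lambda>i. cis (\<theta> i * t)) ** conj_transpose V" for t
  define W' where "W' t = V ** diag_mat (\<lambda>i. \<theta> i *\<^sub>R (\<i> * cis (\<theta> i * t))) ** conj_transpose V" for t
  have one: "diag_mat (\<lambda>i. 1) = (mat 1 :: complex^'n^'n)"
    by (simp add: vec_eq_iff diag_mat_nth mat_def)
  show thesis
  proof
    show "unitary_mat (W t)" for t
      by (simp add: unitary_mat_def W_def conj_transpose_mult unitary_matD(1-4)[OF V]
          diag_mat_mult_left cis_cnj cis_mult one matrix_mul_assoc[symmetric])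
    show "(W has_vector_derivative W' t) (at t)" for t
      unfolding W_def W'_def
    proof (intro has_vector_derivative_matrix_conj has_vector_derivative_diag_mat)
      fix i
      have "((\<lambda>t. cis (\<theta> i * t)) has_vector_derivative \<theta> i *\<^sub>R (\<i> * cis (\<theta> i * t))) (at t)"
        unfolding has_vector_derivative_def
        by (rule has_derivative_eq_rhs[OF has_derivative_cis[OF has_derivative_mult_right[OF has_derivative_ident]]])
          (simp add: fun_eq_iff scaleR_conv_of_real)
      then show "((\<lambda>t. cis (\<theta> i * t)) has_vector_derivative \<theta> i *\<^sub>R (\<i> * cis (\<theta> i * t))) (at t)" .
    qed
    show "continuous_on T W'" for T
      unfolding W'_def
      by (intro continuous_on_matrix_mult continuous_on_diag_mat continuous_intros)
    show "W 0 = mat 1"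
      by (simp add: W_def one unitary_matD(2)[OF V])
    have "W' 0 $ i $ j = \<i> * (\<chi> i j. - \<i> * k $ i $ j) $ i $ j" for i j
      unfolding k W'_def matrix_diag_conj_nth sum_distrib_left
      by (intro sum.cong) (simp_all add: scaleR_conv_of_real)
    then show "W' 0 = k"
      by (simp add: vec_eq_iff)
  qed
qed

lemma has_vector_derivative_conjugation:
  fixes W X :: "real \<Rightarrow> complex^'n^'n"
  assumes "(W has_vector_derivative W') (at t)" "(X has_vector_derivative X') (at t)"
  shows "((\<lambda>t. W t ** X t ** conj_transpose (W t)) has_vector_derivative
    W t ** X t ** conj_transpose W' + (W t ** X' + W' ** X t) ** conj_transpose (W t)) (at t)"
  by (intro has_vector_derivative_matrix_mult assms
      bounded_linear.has_vector_derivative[OF bounded_linear_conj_transpose])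

lemma joint_diagonal_curve_exists:
  fixes x \<delta> :: "'n::finite \<Rightarrow> real^'d" and k :: "complex^'n^'n"
  assumes k: "conj_transpose k = - k"
  obtains S :: "real \<Rightarrow> complex^'n^'n^'d" and \<Delta> :: "complex^'n^'n^'d"
  where "\<And>T. S C1_differentiable_on T" "\<And>t. S t \<in> CSAM" "joint_spectrum (S 0) = range x"
    "(S has_vector_derivative \<Delta>) (at 0)"
    "\<And>r i j. \<Delta> $ r $ i $ j =
      (if i = j then of_real (\<delta> i $ r) else 0) + (x j $ r - x i $ r) *\<^sub>R k $ i $ j"
    "\<forall>f f'. (\<forall>i. (f has_derivative f' i) (at (x i))) \<longrightarrow>
      ((\<lambda>t. joint_calculus f (S t)) has_vector_derivative
        (\<chi> i j. (if i = j then of_real (f' i (\<delta> i)) else 0) + (f (x j) - f (x i)) *\<^sub>R k $ i $ j)) (at 0)"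
proof -
  obtain W W' where W: "\<And>t :: real. unitary_mat (W t)"
    and W': "\<And>t. (W has_vector_derivative W' t) (at t)" and cont_W': "\<And>T. continuous_on T W'"
    and 0: "W 0 = mat 1" "W' 0 = k"
    by (rule unitary_curve_exists[OF k]) (rule that)
  have cont_W: "continuous_on T W" for T
    by (rule continuous_on_vector_derivative) (rule has_vector_derivative_at_within[OF W'])
  have one: "conj_transpose (mat 1) = (mat 1 :: complex^'n^'n)"
    by (simp add: vec_eq_iff mat_def)
  define X where "X r t = diag_mat (\<lambda>i. complex_of_real ((x i + t *\<^sub>R \<delta> i) $ r))" for r t
  define Y where "Y r = diag_mat (\<lambda>i. complex_of_real (\<delta> i $ r))" for r
  have X: "(X r has_vector_derivative Y r) (at t)" for r t
    unfolding X_def Y_def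
    by (intro has_vector_derivative_diag_mat has_vector_derivative_of_real)
      (auto intro!: derivative_eq_intros simp flip: has_real_derivative_iff_has_vector_derivative)
  have cont_X: "continuous_on T (X r)" for T r
    by (rule continuous_on_vector_derivative) (rule has_vector_derivative_at_within[OF X])
  define S where "S t = (\<chi> r. W t ** X r t ** conj_transpose (W t))" for t
  define D where "D t = (\<chi> r. W t ** X r t ** conj_transpose (W' t) +
    (W t ** Y r + W' t ** X r t) ** conj_transpose (W t))" for t
  have S: "joint_diagonalization (W t) (\<lambda>i. x i + t *\<^sub>R \<delta> i) (S t)" for t
    using W by (simp add: joint_diagonalization_def S_def X_def)
  have SD: "(S has_vector_derivative D t) (at t)" for t
    unfolding S_def D_def
    by (rule has_vector_derivative_vecI, unfold vec_lambda_beta)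
      (rule has_vector_derivative_conjugation[OF W' X])
  have at_0: "(W 0 ** diag_mat a ** conj_transpose (W' 0) +
      (W 0 ** diag_mat b + W' 0 ** diag_mat a) ** conj_transpose (W 0)) $ i $ j =
    (if i = j then b i else 0) + (a j - a i) * k $ i $ j" for a b i j
  proof -
    have kk: "cnj (k $ j $ i) = - (k $ i $ j)"
      using k by (simp add: vec_eq_iff)
    have "(diag_mat a ** conj_transpose k) $ i $ j = a i * cnj (k $ j $ i)"
      by (simp add: diag_mat_mult_nth)
    then show ?thesis
      by (simp add: 0 one kk diag_mat_mult_nth diag_mat_nth algebra_simps)
  qed
  have 1: "S C1_differentiable_on T" for T
    unfolding C1_differentiable_on_def
  proof (intro exI[of _ D] conjI ballI SD)
    show "continuous_on T D"
      unfolding D_def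
      by (intro continuous_on_vec_lambda continuous_on_add continuous_on_matrix_mult
          continuous_on_conj_transpose cont_W cont_W' cont_X continuous_on_const)
  qed
  have 2: "S t \<in> CSAM" for t
    by (rule joint_diagonalization_CSAM[OF S])
  have 3: "joint_spectrum (S 0) = range x"
    using joint_spectrum_eq_range[OF S, of 0] by simp
  have 4: "D 0 $ r $ i $ j =
      (if i = j then of_real (\<delta> i $ r) else 0) + (x j $ r - x i $ r) *\<^sub>R k $ i $ j" for r i j
    unfolding D_def vec_lambda_beta X_def Y_def at_0 by (simp add: scaleR_conv_of_real)
  have 5: "((\<lambda>t. joint_calculus f (S t)) has_vector_derivative
        (\<chi> i j. (if i = j then of_real (f' i (\<delta> i)) else 0) + (f (x j) - f (x i)) *\<^sub>R k $ i $ j)) (at 0)"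
    if f: "\<And>i. (f has_derivative f' i) (at (x i))" for f f'
  proof -
    define F where "F t = diag_mat (\<lambda>i. complex_of_real (f (x i + t *\<^sub>R \<delta> i)))" for t
    define G where "G = diag_mat (\<lambda>i. complex_of_real (f' i (\<delta> i)))"
    have "(F has_vector_derivative G) (at 0)"
      unfolding F_def G_def
    proof (intro has_vector_derivative_diag_mat has_vector_derivative_of_real)
      fix i
      have "((\<lambda>t. x i + t *\<^sub>R \<delta> i) has_derivative (\<lambda>t. t *\<^sub>R \<delta> i)) (at 0)"
        by (auto intro!: derivative_eq_intros)
      moreover have "(f has_derivative f' i) (at (x i + 0 *\<^sub>R \<delta> i))"
        using f by simp
      ultimately have "((\<lambda>t. f (x i + t *\<^sub>R \<delta> i)) has_derivative (\<lambda>t. f' i (t *\<^sub>R \<delta> i))) (at 0)"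
        by (rule has_derivative_compose)
      then show "((\<lambda>t. f (x i + t *\<^sub>R \<delta> i)) has_real_derivative f' i (\<delta> i)) (at 0)"
        by (simp add: has_real_derivative_iff_has_vector_derivative has_vector_derivative_def
            linear_scale[OF has_derivative_linear[OF f]])
    qed
    from has_vector_derivative_conjugation[OF W' this]
    have "((\<lambda>t. W t ** F t ** conj_transpose (W t)) has_vector_derivative
        W 0 ** F 0 ** conj_transpose (W' 0) + (W 0 ** G + W' 0 ** F 0) ** conj_transpose (W 0)) (at 0)" .
    also have "(\<lambda>t. W t ** F t ** conj_transpose (W t)) = (\<lambda>t. joint_calculus f (S t))"
      by (simp add: joint_calculus_eq[OF S] F_def)
    also have "W 0 ** F 0 ** conj_transpose (W' 0) + (W 0 ** G + W' 0 ** F 0) ** conj_transpose (W 0) =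
      (\<chi> i j. (if i = j then of_real (f' i (\<delta> i)) else 0) + (f (x j) - f (x i)) *\<^sub>R k $ i $ j)"
      unfolding F_def G_def vec_eq_iff at_0 by (simp add: scaleR_conv_of_real)
    finally show ?thesis .
  qed
  show thesis
    by (rule that[of S "D 0", OF 1 2 3 SD 4]) (intro allI impI, rule 5, erule spec)
qed

subsection \<open>Separation from the cone of positive semidefinite tuples\<close>

definition trace_sum :: "complex^'n^'n^'d \<Rightarrow> real" where
  "trace_sum A = (\<Sum>r\<in>UNIV. \<Sum>i\<in>UNIV. Re (A $ r $ i $ i))"

definition psd_tuples :: "(complex^'n^'n^'d) set" where
  "psd_tuples = {A. \<forall>r. psd (A $ r)}"

lemma closed_psd_tuples: "closed psd_tuples"
proof -
  have "closed {A :: complex^'n^'n^'d. psd (A $ r)}" for r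
    using closed_vimage[OF closed_psd, of "\<lambda>A :: complex^'n^'n^'d. A $ r"]
    by (simp add: vimage_def continuous_intros)
  then show ?thesis
    unfolding psd_tuples_def by (intro closed_Collect_all)
qed

lemma psd_tuples_single:
  "(\<chi> s. if s = r then (\<chi> i j. w $ i * cnj (w $ j)) else 0) \<in> psd_tuples"
  by (simp add: psd_tuples_def psd_rank_one psd_0)

lemma trace_sum_linear: "linear trace_sum"
  unfolding trace_sum_def
  by (rule linearI) (simp_all add: sum.distrib sum_distrib_left)

definition psd_tuples_trace_1 :: "(complex^'n^'n^'d) set" where
  "psd_tuples_trace_1 = {A \<in> psd_tuples. trace_sum A = 1}"

lemma psd_tuple_norm_le:
  assumes "A \<in> psd_tuples"
  shows "norm (A :: complex^'n^'n^'d) \<le> CARD('d) * (CARD('n) * (CARD('n) * trace_sum A))"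
proof -
  have A: "psd (A $ r)" for r using assms by (simp add: psd_tuples_def)
  have diag: "Re (A $ r $ i $ i) \<le> trace_sum A" for r i
  proof -
    have "Re (A $ r $ i $ i) \<le> (\<Sum>i\<in>UNIV. Re (A $ r $ i $ i))"
      by (rule member_le_sum) (auto simp: psd_diagonal(2)[OF A])
    also have "\<dots> \<le> trace_sum A"
      unfolding trace_sum_def
      by (rule member_le_sum[where f = "\<lambda>r. \<Sum>i\<in>UNIV. Re (A $ r $ i $ i)"])
        (auto intro!: sum_nonneg psd_diagonal(2)[OF A])
    finally show ?thesis .
  qed
  have "norm (A $ r $ i $ j) \<le> trace_sum A" for r i j
    using psd_entry_bound[OF A, of r i j] diag[of r i] diag[of r j] by linarith
  then have "norm (A $ r) \<le> CARD('n) * (CARD('n) * trace_sum A)" for r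
    by (rule norm_matrix_le)
  then show ?thesis
    by (intro order.trans[OF norm_vec_le_sum[of A]]) (intro sum_bounded_above)
qed

lemma compact_psd_tuples_trace_1:
  "compact (psd_tuples_trace_1 :: (complex^'n::finite^'n^'d::finite) set)"
proof -
  have "closed {A :: complex^'n^'n^'d. trace_sum A = 1}"
    unfolding trace_sum_def by (intro closed_Collect_eq continuous_intros)
  then have "closed (psd_tuples_trace_1 :: (complex^'n^'n^'d) set)"
    using closed_Int[OF closed_psd_tuples] by (simp add: psd_tuples_trace_1_def Collect_conj_eq)
  moreover have "norm A \<le> CARD('d) * (CARD('n) * (CARD('n) * 1))"
    if "A \<in> psd_tuples_trace_1" for A :: "complex^'n^'n^'d"
    using psd_tuple_norm_le[of A] that by (simp add: psd_tuples_trace_1_def)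
  then have "bounded (psd_tuples_trace_1 :: (complex^'n^'n^'d) set)"
    unfolding bounded_iff by blast
  ultimately show ?thesis by (simp add: compact_eq_bounded_closed)
qed

lemma convex_psd_tuples_trace_1: "convex psd_tuples_trace_1"
  unfolding convex_def psd_tuples_trace_1_def psd_tuples_def
  by (simp add: psd_add psd_scaleR linear_add[OF trace_sum_linear] linear_scale[OF trace_sum_linear])

lemma psd_tuples_trace_1_nonempty: "psd_tuples_trace_1 \<noteq> ({} :: (complex^'n::finite^'n^'d::finite) set)"
proof -
  obtain r :: 'd and k :: 'n where True by blast
  define A :: "complex^'n^'n^'d" where
    "A = (\<chi> s. if s = r then (\<chi> i j. axis k 1 $ i * cnj (axis k 1 $ j)) else 0)"
  have "Re (A $ s $ i $ i) = (if i = k then if s = r then 1 else 0 else 0)" for s i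
    by (simp add: A_def axis_def)
  then have "trace_sum A = 1"
    by (simp add: trace_sum_def)
  then have "A \<in> psd_tuples_trace_1"
    using psd_tuples_single by (auto simp: psd_tuples_trace_1_def A_def)
  then show ?thesis by blast
qed

definition Loewner_map ::
    "('n \<Rightarrow> real^'d) \<Rightarrow> complex^'n^'n^'d \<Rightarrow> (real^'n^'d) \<times> (complex^'n^'n)" where
  "Loewner_map x A = ((\<chi> r i. Re (A $ r $ i $ i)),
    (\<chi> i j. \<Sum>r\<in>UNIV. (x j $ r - x i $ r) *\<^sub>R A $ r $ i $ j))"

lemma Loewner_map_linear: "linear (Loewner_map x)"
  by (rule linearI)
    (simp_all add: Loewner_map_def vec_eq_iff sum.distrib scaleR_add_right scaleR_sum_right mult.commute)

text \<open>The cone of values of \<open>Loewner_map x\<close> on tuples of positive semidefinite matrices is closed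
  because it is spanned by a compact convex base that misses \<open>0\<close>; hence a value outside it is cut
  off by a linear functional \<open>(a, c)\<close>.\<close>

lemma Loewner_map_separation:
  fixes x :: "'n::finite \<Rightarrow> real^'d::finite"
  assumes "b \<notin> Loewner_map x ` psd_tuples"
  obtains a c where "(a, c) \<bullet> b < 0" "\<And>A. A \<in> psd_tuples \<Longrightarrow> 0 \<le> (a, c) \<bullet> Loewner_map x A"
proof -
  let ?P = "psd_tuples_trace_1 :: (complex^'n^'n^'d) set"
  define C where "C = conic hull (Loewner_map x ` ?P)"
  have C: "C = {t *\<^sub>R Loewner_map x A |t A. 0 \<le> t \<and> A \<in> ?P}"
    unfolding C_def conic_hull_explicit by blast
  have "compact (Loewner_map x ` ?P)"
    by (intro compact_continuous_image compact_psd_tuples_trace_1 linear_continuous_on)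
      (simp add: Loewner_map_linear flip: linear_conv_bounded_linear)
  moreover have "0 \<notin> Loewner_map x ` ?P"
  proof
    assume "0 \<in> Loewner_map x ` ?P"
    then obtain A where A: "A \<in> ?P" "fst (Loewner_map x A) = 0" by force
    then have "Re (A $ r $ i $ i) = 0" for r i
      by (simp add: Loewner_map_def vec_eq_iff)
    then have "trace_sum A = 0" by (simp add: trace_sum_def)
    with A show False by (simp add: psd_tuples_trace_1_def)
  qed
  ultimately have "closed C"
    unfolding C_def by (intro closed_conic_hull) blast
  have "convex C"
    unfolding C_def
    by (intro convex_conic_hull convex_linear_image Loewner_map_linear convex_psd_tuples_trace_1)
  have C_sub: "C \<subseteq> Loewner_map x ` psd_tuples"
  proof
    fix y assume "y \<in> C"
    then obtain t A where "0 \<le> t" "A \<in> ?P" "y = t *\<^sub>R Loewner_map x A"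
      unfolding C by blast
    then have "y = Loewner_map x (t *\<^sub>R A)" "t *\<^sub>R A \<in> psd_tuples"
      by (simp_all add: linear_scale[OF Loewner_map_linear] psd_tuples_trace_1_def psd_tuples_def
          psd_scaleR)
    then show "y \<in> Loewner_map x ` psd_tuples" by blast
  qed
  then have "b \<notin> C" using assms by blast
  with \<open>convex C\<close> \<open>closed C\<close> obtain h \<beta> where h: "h \<bullet> b < \<beta>" "\<And>y. y \<in> C \<Longrightarrow> \<beta> < h \<bullet> y"
    using separating_hyperplane_closed_point by metis
  obtain A0 where "A0 \<in> ?P" using psd_tuples_trace_1_nonempty by blast
  then have "0 *\<^sub>R Loewner_map x A0 \<in> C" unfolding C by blast
  with h(2) have "\<beta> < 0" by fastforce
  have nonneg: "0 \<le> h \<bullet> Loewner_map x A" if "A \<in> ?P" for A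
  proof (rule ccontr)
    assume neg: "\<not> 0 \<le> h \<bullet> Loewner_map x A"
    define t where "t = \<beta> / (h \<bullet> Loewner_map x A)"
    have "0 \<le> t" using neg \<open>\<beta> < 0\<close> by (simp add: t_def divide_nonpos_neg)
    then have "t *\<^sub>R Loewner_map x A \<in> C" unfolding C using that by blast
    with h(2) have "\<beta> < t * (h \<bullet> Loewner_map x A)" by fastforce
    then show False using neg by (simp add: t_def)
  qed
  have "0 \<le> h \<bullet> Loewner_map x A" if A: "A \<in> psd_tuples" for A
  proof (cases "A = 0")
    case True
    then show ?thesis by (simp add: linear_0[OF Loewner_map_linear])
  next
    case False
    have "0 < norm A" using False by simp
    also have "\<dots> \<le> CARD('d) * (CARD('n) * (CARD('n) * trace_sum A))"
      by (rule psd_tuple_norm_le[OF A])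
    finally have tr: "0 < trace_sum A"
      by (simp add: zero_less_mult_iff)
    define B where "B = (1 / trace_sum A) *\<^sub>R A"
    have "B \<in> ?P"
      using A tr by (simp add: B_def psd_tuples_trace_1_def psd_tuples_def psd_scaleR
          linear_scale[OF trace_sum_linear])
    moreover have "A = trace_sum A *\<^sub>R B"
      using tr by (simp add: B_def)
    then have "h \<bullet> Loewner_map x A = trace_sum A * (h \<bullet> Loewner_map x B)"
      by (metis linear_scale[OF Loewner_map_linear] inner_scaleR_right)
    ultimately show ?thesis
      using nonneg[of B] tr by simp
  qed
  moreover have "h \<bullet> b < 0" using h(1) \<open>\<beta> < 0\<close> by simp
  ultimately show thesis
    using that[of "fst h" "snd h"] by simp
qed

lemma inner_matrix: "(A :: complex^'n^'m) \<bullet> B = (\<Sum>i\<in>UNIV. \<Sum>j\<in>UNIV. A $ i $ j \<bullet> B $ i $ j)"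
  by (simp add: inner_vec_def)

text \<open>The adjoint of \<open>Loewner_map x\<close>, which has the form of a velocity of a curve of commuting
  matrices through \<open>diag x\<close>.\<close>

lemma Loewner_map_adjoint:
  fixes k :: "complex^'n^'n" and A :: "complex^'n^'n^'d"
  assumes A: "\<And>r. psd (A $ r)"
    and \<Delta>: "\<And>r i j. \<Delta> $ r $ i $ j =
      (if i = j then of_real (a $ r $ i) else 0) + (x j $ r - x i $ r) *\<^sub>R k $ i $ j"
  shows "(a, k) \<bullet> Loewner_map x A = (\<Sum>r\<in>UNIV. \<Delta> $ r \<bullet> A $ r)"
proof -
  have "\<Delta> $ r \<bullet> A $ r = (\<Sum>i\<in>UNIV. a $ r $ i * Re (A $ r $ i $ i)) +
      (\<Sum>i\<in>UNIV. \<Sum>j\<in>UNIV. (x j $ r - x i $ r) * (k $ i $ j \<bullet> A $ r $ i $ j))" for r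
  proof -
    have "\<Delta> $ r $ i $ j \<bullet> A $ r $ i $ j =
        (if i = j then a $ r $ i * Re (A $ r $ i $ i) else 0) +
        (x j $ r - x i $ r) * (k $ i $ j \<bullet> A $ r $ i $ j)" for i j
      by (simp add: \<Delta> inner_add_left inner_complex_def algebra_simps)
    then show ?thesis
      by (simp add: inner_matrix sum.distrib)
  qed
  then have "(\<Sum>r\<in>UNIV. \<Delta> $ r \<bullet> A $ r) = (\<Sum>r\<in>UNIV. \<Sum>i\<in>UNIV. a $ r $ i * Re (A $ r $ i $ i)) +
      (\<Sum>r\<in>UNIV. \<Sum>i\<in>UNIV. \<Sum>j\<in>UNIV. (x j $ r - x i $ r) * (k $ i $ j \<bullet> A $ r $ i $ j))"
    by (simp only: sum.distrib)
  also have "(\<Sum>r\<in>UNIV. \<Sum>i\<in>UNIV. \<Sum>j\<in>UNIV. (x j $ r - x i $ r) * (k $ i $ j \<bullet> A $ r $ i $ j)) =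
      (\<Sum>i\<in>UNIV. \<Sum>r\<in>UNIV. \<Sum>j\<in>UNIV. (x j $ r - x i $ r) * (k $ i $ j \<bullet> A $ r $ i $ j))"
    by (rule sum.swap)
  also have "\<dots> = (\<Sum>i\<in>UNIV. \<Sum>j\<in>UNIV. \<Sum>r\<in>UNIV. (x j $ r - x i $ r) * (k $ i $ j \<bullet> A $ r $ i $ j))"
    by (rule sum.cong[OF refl sum.swap])
  finally show ?thesis
    by (simp add: Loewner_map_def inner_vec_def inner_sum_right)
qed

theorem locally_Mn_monotone_imp_Loewner_class:
  fixes f :: "real^'d::finite \<Rightarrow> real"
  assumes f: "locally_Mn_monotone TYPE('n::finite) E f"
  shows "f \<in> Loewner_class TYPE('n) E"
proof -
  have C1: "C1_on E f" using f by (simp add: locally_Mn_monotone_def)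
  have "\<exists>A :: complex^'n^'n^'d. (\<forall>r. psd (A $ r)) \<and>
      (\<forall>i r. A $ r $ i $ i = of_real (partial_deriv r f (x i))) \<and>
      (\<forall>i j. of_real (f (x j) - f (x i)) =
        (\<Sum>r\<in>UNIV. of_real (x j $ r - x i $ r) * A $ r $ i $ j))"
    if x: "inj x" "range x \<subseteq> E" for x :: "'n \<Rightarrow> real^'d"
  proof -
    have "\<forall>i. \<exists>f'. (f has_derivative f') (at (x i))"
    proof
      fix i
      have "x i \<in> E" using x(2) by blast
      then show "\<exists>f'. (f has_derivative f') (at (x i))"
        by (rule C1_on_has_derivative[OF C1]) (rule exI)
    qed
    from choice[OF this] obtain f' where f': "\<And>i. (f has_derivative f' i) (at (x i))"
      by (elim exE) (rule that, elim allE)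
    define b2 where "b2 = (\<chi> i j. complex_of_real (f (x j) - f (x i)))"
    define b where "b = ((\<chi> r i. partial_deriv r f (x i)), b2)"
    have "b \<in> Loewner_map x ` psd_tuples"
    proof (rule ccontr)
      assume "b \<notin> Loewner_map x ` psd_tuples"
      then obtain a c where neg: "(a, c) \<bullet> b < 0"
        and nonneg: "\<And>A. A \<in> psd_tuples \<Longrightarrow> 0 \<le> (a, c) \<bullet> Loewner_map x A"
        by (rule Loewner_map_separation) (rule that)
      define k :: "complex^'n^'n" where "k = (\<chi> i j. (c $ i $ j - cnj (c $ j $ i)) / 2)"
      have k: "conj_transpose k = - k"
        by (simp add: vec_eq_iff k_def field_simps)
      have c_k: "c \<bullet> Z = k \<bullet> Z" if "\<And>i j. cnj (Z $ j $ i) = - Z $ i $ j" for Z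
        unfolding k_def by (rule skew_part_inner[OF that])
      define \<delta> where "\<delta> i = (\<chi> r. a $ r $ i)" for i
      obtain S :: "real \<Rightarrow> complex^'n^'n^'d" and \<Delta> where
        S: "\<And>T. S C1_differentiable_on T" "\<And>t. S t \<in> CSAM" "joint_spectrum (S 0) = range x"
          "(S has_vector_derivative \<Delta>) (at 0)"
        and \<Delta>: "\<And>r i j. \<Delta> $ r $ i $ j =
          (if i = j then of_real (\<delta> i $ r) else 0) + (x j $ r - x i $ r) *\<^sub>R k $ i $ j"
        and fS: "\<forall>f f'. (\<forall>i. (f has_derivative f' i) (at (x i))) \<longrightarrow>
          ((\<lambda>t. joint_calculus f (S t)) has_vector_derivative
            (\<chi> i j. (if i = j then of_real (f' i (\<delta> i)) else 0) +
              (f (x j) - f (x i)) *\<^sub>R k $ i $ j)) (at 0)"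
        by (rule joint_diagonal_curve_exists[OF k, of x \<delta>]) (rule that)
      have \<Delta>': "\<Delta> $ r $ i $ j =
          (if i = j then of_real (a $ r $ i) else 0) + (x j $ r - x i $ r) *\<^sub>R k $ i $ j" for r i j
        by (simp add: \<Delta> \<delta>_def)
      have kc: "cnj (k $ j $ i) = - (k $ i $ j)" for i j
        using k by (simp add: vec_eq_iff)
      have psd_\<Delta>: "psd (\<Delta> $ r)" for r
        unfolding psd_iff_cdot
      proof (intro conjI allI)
        show "self_adjoint (\<Delta> $ r)"
          by (auto simp: self_adjoint_iff \<Delta>' kc algebra_simps)
        fix w :: "complex^'n"
        define A :: "complex^'n^'n^'d" where "A = (\<chi> s. if s = r then (\<chi> i j. w $ i * cnj (w $ j)) else 0)"
        have A: "A \<in> psd_tuples" unfolding A_def by (rule psd_tuples_single)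
        then have pA: "psd (A $ r)" for r by (simp add: psd_tuples_def)
        have skew: "cnj (snd (Loewner_map x A) $ j $ i) = - snd (Loewner_map x A) $ i $ j" for i j
        proof -
          have "cnj (A $ r $ j $ i) = A $ r $ i $ j" for r
            using psdD(1)[OF pA] by (simp add: self_adjoint_iff)
          then show ?thesis
            by (simp add: Loewner_map_def algebra_simps flip: sum_negf)
        qed
        have "0 \<le> (a, c) \<bullet> Loewner_map x A"
          by (rule nonneg[OF A])
        also have "\<dots> = (a, k) \<bullet> Loewner_map x A"
          using c_k[OF skew] by (simp add: inner_prod_def)
        also have "\<dots> = (\<Sum>s\<in>UNIV. \<Delta> $ s \<bullet> A $ s)"
          by (rule Loewner_map_adjoint[OF pA \<Delta>'])
        also have "\<dots> = (\<Sum>s\<in>UNIV. if s = r then \<Delta> $ r \<bullet> (\<chi> i j. w $ i * cnj (w $ j)) else 0)"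
          by (intro sum.cong) (auto simp: A_def)
        also have "\<dots> = \<Delta> $ r \<bullet> (\<chi> i j. w $ i * cnj (w $ j))"
          by simp
        also have "\<dots> = Re (cdot w (\<Delta> $ r *v w))"
          unfolding cdot_matrix_vector_mult inner_matrix Re_sum
          by (intro sum.cong refl) (simp add: inner_complex_def algebra_simps)
        finally show "0 \<le> Re (cdot w (\<Delta> $ r *v w))" .
      qed
      obtain D where D: "((\<lambda>t. joint_calculus f (S t)) has_vector_derivative D) (at 0)" "psd D"
        using f[unfolded locally_Mn_monotone_def, THEN conjunct2, THEN spec[of _ x], THEN spec[of _ S],
            THEN spec[of _ \<Delta>], THEN spec[of _ 1]] x S psd_\<Delta> by auto
      have D_eq: "D = (\<chi> i j. (if i = j then of_real (f' i (\<delta> i)) else 0) +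
              (f (x j) - f (x i)) *\<^sub>R k $ i $ j)"
        by (rule vector_derivative_unique_at[OF D(1) fS[rule_format, OF f']])
      have "0 \<le> Re (cdot 1 (D *v 1))"
        by (rule psdD(2)[OF D(2)])
      also have "\<dots> = (\<Sum>i\<in>UNIV. \<Sum>j\<in>UNIV. Re (D $ i $ j))"
        by (simp add: cdot_matrix_vector_mult)
      also have "\<dots> = (\<Sum>i\<in>UNIV. \<Sum>j\<in>UNIV. (if i = j then f' i (\<delta> i) else 0) + k $ i $ j \<bullet> b2 $ i $ j)"
        by (intro sum.cong refl) (simp add: D_eq b2_def inner_complex_def)
      also have "\<dots> = (\<Sum>i\<in>UNIV. f' i (\<delta> i)) + k \<bullet> b2"
        by (simp add: sum.distrib inner_matrix)
      also have "k \<bullet> b2 = c \<bullet> b2"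
        by (rule c_k[symmetric]) (simp add: b2_def)
      also have "(\<Sum>i\<in>UNIV. f' i (\<delta> i)) = (\<Sum>i\<in>UNIV. \<Sum>r\<in>UNIV. a $ r $ i * partial_deriv r f (x i))"
        by (intro sum.cong refl) (simp add: has_derivative_partial_deriv[OF f'] \<delta>_def mult.commute)
      also have "\<dots> = (\<Sum>r\<in>UNIV. \<Sum>i\<in>UNIV. a $ r $ i * partial_deriv r f (x i))"
        by (rule sum.swap)
      also have "\<dots> + c \<bullet> b2 = (a, c) \<bullet> b"
        by (simp add: b_def inner_vec_def)
      finally show False using neg by simp
    qed
    then obtain A where A: "\<And>r. psd (A $ r)" and b: "b = Loewner_map x A"
      by (auto simp: psd_tuples_def)
    have "Re (A $ r $ i $ i) = partial_deriv r f (x i)" for r i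
      using arg_cong[OF b, of "\<lambda>z. fst z $ r $ i"] by (simp add: b_def Loewner_map_def)
    then have "A $ r $ i $ i = of_real (partial_deriv r f (x i))" for r i
      using psd_diagonal(1)[OF A] by metis
    moreover have "of_real (f (x j) - f (x i)) =
        (\<Sum>r\<in>UNIV. of_real (x j $ r - x i $ r) * A $ r $ i $ j)" for i j
      using arg_cong[OF b, of "\<lambda>z. snd z $ i $ j"]
      by (simp only: b_def b2_def Loewner_map_def snd_conv vec_lambda_beta scaleR_conv_of_real)
    ultimately show ?thesis using A by blast
  qed
  with C1 show ?thesis by (simp add: Loewner_class_def)
qed

theorem theorem1p11:
  fixes E :: "(real^'d::finite) set" and f :: "real^'d \<Rightarrow> real"
  assumes "open E" and "C1_on E f"
  shows "locally_Mn_monotone TYPE('n::finite) E f \<longleftrightarrow> f \<in> Loewner_class TYPE('n) E"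
  using locally_Mn_monotone_imp_Loewner_class Loewner_class_imp_locally_Mn_monotone by blast

end
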